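(* Let $d=2$ and let $V:\mathbb{R}\to\mathbb{R}$ be an even $C^2$ function with $0\le V''(x)\le \overline{c}$ for all $x$, where $\overline c>0$. Then there exist a constant $C>0$, depending only on $p$, and a number $\mathfrak{e}_0\in(0,1)$ such that the following holds. For all $a,b,\beta>0$ such that $$\overline{\mathfrak e}:=2a\sqrt{\beta\overline c}\,(\mathrm{e}^{b}-1)$$ satisfies $\overline{\mathfrak e}\le \mathfrak e_0$ and such that $2a\sqrt{\beta\overline c}\le|\log\overline{\mathfrak e}|^{1/2}$, $$\liminf_{\Lambda\nearrow\mathbb{Z}^2}\mu_\Lambda^{a,b}(\phi_0^2)\ \ge\ \frac{C}{\overline c\,\beta}\,|\log\overline{\mathfrak e}|.$$ The same holds for $\delta$-pinning: for all $\varepsilon,\beta>0$ such that $\overline{\mathfrak e}:=\varepsilon\sqrt{\beta\overline c}\le\mathfrak e_0$, $$\liminf_{\Lambda\nearrow\mathbb{Z}^2}\mu_\Lambda^{\varepsilon}(\phi_0^2)\ \ge\ \frac{C}{\overline c\,\beta}\,|\log\overline{\mathfrak e}|.$$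
   Context: Here $d=2$. $p:\mathbb{Z}^2\to[0,1]$ satisfies $p(x)=p(-x)$, $\sum_x p(x)=1$, is irreducible (for every $x$ there is a path $0=x_0,x_1,\dots,x_n=x$ with $p(x_k-x_{k-1})>0$ for all $k$), and $\sum_x p(x)|x|^{2+\delta}<\infty$ for some $\delta>0$. The function $V$ is even, convex and non-constant. For finite $\Lambda\subset\mathbb{Z}^2$ and $\beta>0$, let $H_\Lambda(\phi)=\frac{\beta}{2}\sum_{x,y}p(x-y)\,[V(\phi_x-\phi_y)-V(0)]$, the sum being over all ordered pairs $(x,y)\in\mathbb{Z}^2\times\mathbb{Z}^2$, for fields $\phi$ vanishing outside $\Lambda$ (subtracting $V(0)$ only removes a constant which cancels in normalizations). The free measure with $0$-boundary conditions is the probability measure on $\mathbb{R}^{\mathbb{Z}^2}$ $$\mu_\Lambda(\mathrm d\phi)=\frac{1}{Z_\Lambda}\mathrm{e}^{-H_\Lambda(\phi)}\prod_{x\in\Lambda}\mathrm d\phi_x\prod_{x\notin\Lambda}\delta_0(\mathrm d\phi_x).$$ For $a,b>0$, the square-well pinning measure is $$\mu_\Lambda^{a,b}(\,\cdot\,)=\frac{\mu_\Lambda\big(\,\cdot\,\exp[b\sum_{x\in\Lambda}\mathrm I(|\phi_x|\le a)]\big)}{\mu_\Lambda\big(\exp[b\sum_{x\in\Lambda}\mathrm I(|\phi_x|\le a)]\big)}.$$ For $\varepsilon>0$, the $\delta$-pinning measure is $$\mu_\Lambda^{\varepsilon}(\mathrm d\phi)=\frac{1}{Z_\Lambda^\varepsilon}\mathrm{e}^{-H_\Lambda(\phi)}\prod_{x\in\Lambda}(\mathrm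 d\phi_x+\varepsilon\delta_0(\mathrm d\phi_x))\prod_{x\notin\Lambda}\delta_0(\mathrm d\phi_x).$$ $\mu(f)$ denotes the expectation of $f$ under $\mu$. $\Lambda\nearrow\mathbb{Z}^2$ means along finite subsets ordered by inclusion. *)

theory Defs
  imports "HOL-Probability.Probability"
begin

type_synonym site = "int \<times> int"
type_synonym field_config = "site \<Rightarrow> real"

definition site_norm :: "site \<Rightarrow> real" where
  "site_norm x = sqrt ((real_of_int (fst x))\<^sup>2 + (real_of_int (snd x))\<^sup>2)"

definition irreducible_kernel :: "(site \<Rightarrow> real) \<Rightarrow> bool" where
  "irreducible_kernel p \<longleftrightarrow>
     (\<forall>x. \<exists>(n::nat) w. w 0 = 0 \<and> w n = x \<and> (\<forall>k\<in>{1..n}. p (w k - w (k - 1)) > 0))"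

definition admissible_kernel :: "(site \<Rightarrow> real) \<Rightarrow> bool" where
  "admissible_kernel p \<longleftrightarrow>
     (\<forall>x. 0 \<le> p x \<and> p x \<le> 1) \<and>
     (\<forall>x. p (- x) = p x) \<and>
     (p has_sum 1) UNIV \<and>
     irreducible_kernel p \<and>
     (\<exists>\<delta>>0. (\<lambda>x. p x * site_norm x powr (2 + \<delta>)) summable_on UNIV)"

definition C2_function :: "(real \<Rightarrow> real) \<Rightarrow> bool" where
  "C2_function V \<longleftrightarrow>
     (\<forall>x. V differentiable (at x)) \<and>
     (\<forall>x. deriv V differentiable (at x)) \<and>
     continuous_on UNIV (deriv (deriv V))"

(* One formula for every finite volume: the series has nonnegative terms for V even and convex,
   and it converges when p is summable and the field vanishes outside a finite set. *)
definition hamiltonian ::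
  "(site \<Rightarrow> real) \<Rightarrow> (real \<Rightarrow> real) \<Rightarrow> real \<Rightarrow> field_config \<Rightarrow> real" where
  "hamiltonian p V \<beta> \<phi> =
     \<beta> / 2 * (\<Sum>\<^sub>\<infinity>(x, y)\<in>UNIV. p (x - y) * (V (\<phi> x - \<phi> y) - V 0))"

(* lborel + eps * dirac 0 *)
definition pinned_lborel :: "real \<Rightarrow> real measure" where
  "pinned_lborel \<epsilon> =
     measure_of UNIV (sets borel) (\<lambda>A. emeasure lborel A + ennreal \<epsilon> * indicator A 0)"

lemma space_pinned_lborel [simp]: "space (pinned_lborel \<epsilon>) = UNIV"
  by (simp add: pinned_lborel_def space_measure_of_conv)

lemma sets_pinned_lborel [simp, measurable_cong]: "sets (pinned_lborel \<epsilon>) = sets borel"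
  using sets.sigma_sets_eq[of "borel :: real measure"]
  by (simp add: pinned_lborel_def)

lemma emeasure_pinned_lborel:
  assumes A: "A \<in> sets borel"
  shows "emeasure (pinned_lborel \<epsilon>) A = emeasure lborel A + ennreal \<epsilon> * indicator A 0"
proof -
  let ?f = "\<lambda>A. emeasure lborel A + ennreal \<epsilon> * emeasure (return borel (0::real)) A"
  have "countably_additive (sets borel) ?f"
  proof (rule countably_additiveI)
    fix B :: "nat \<Rightarrow> real set"
    assume B: "range B \<subseteq> sets borel" "disjoint_family B"
    have "(\<Sum>i. ?f (B i)) = (\<Sum>i. emeasure lborel (B i)) +
            ennreal \<epsilon> * (\<Sum>i. emeasure (return borel (0::real)) (B i))"
      by (subst suminf_add[symmetric]) auto
    then show "(\<Sum>i. ?f (B i)) = ?f (\<Union>i. B i)"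
      using B suminf_emeasure[of B lborel] suminf_emeasure[of B "return borel (0::real)"] by simp
  qed
  moreover have "countably_additive (sets borel) ?f \<longleftrightarrow>
      countably_additive (sets borel)
        (\<lambda>A. emeasure lborel A + ennreal \<epsilon> * indicator A (0::real))"
    unfolding countably_additive_def by (intro all_cong1 imp_cong refl) (auto simp: subset_eq)
  ultimately show ?thesis
    using A sets.sigma_sets_eq[of "borel :: real measure"]
    by (intro emeasure_measure_of[OF pinned_lborel_def]) (auto simp: positive_def)
qed

(* Product over L of the single-site measure M, and of the Dirac mass at 0 outside L:
   the image of the finite product measure under extension by zero. *)
definition reference_measure :: "real measure \<Rightarrow> site set \<Rightarrow> field_config measure" where
  "reference_measure M \<Lambda> =
     distr (\<Pi>\<^sub>M x\<in>\<Lambda>. M) (\<Pi>\<^sub>M x\<in>UNIV. borel) (\<lambda>\<phi> x. if x \<in> \<Lambda> then \<phi> x else 0)"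

definition normalized_density :: "'a measure \<Rightarrow> ('a \<Rightarrow> real) \<Rightarrow> 'a measure" where
  "normalized_density M f =
     density M (\<lambda>x. ennreal (f x) / (\<integral>\<^sup>+ y. ennreal (f y) \<partial>M))"

definition free_measure ::
  "(site \<Rightarrow> real) \<Rightarrow> (real \<Rightarrow> real) \<Rightarrow> real \<Rightarrow> site set \<Rightarrow> field_config measure" where
  "free_measure p V \<beta> \<Lambda> =
     normalized_density (reference_measure lborel \<Lambda>) (\<lambda>\<phi>. exp (- hamiltonian p V \<beta> \<phi>))"

definition square_well_measure ::
  "(site \<Rightarrow> real) \<Rightarrow> (real \<Rightarrow> real) \<Rightarrow> real \<Rightarrow> real \<Rightarrow> real \<Rightarrow> site set \<Rightarrow> field_config measure" where
  "square_well_measure p V \<beta> a b \<Lambda> =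
     normalized_density (free_measure p V \<beta> \<Lambda>)
       (\<lambda>\<phi>. exp (b * (\<Sum>x\<in>\<Lambda>. of_bool (\<bar>\<phi> x\<bar> \<le> a))))"

definition delta_pinned_measure ::
  "(site \<Rightarrow> real) \<Rightarrow> (real \<Rightarrow> real) \<Rightarrow> real \<Rightarrow> real \<Rightarrow> site set \<Rightarrow> field_config measure" where
  "delta_pinned_measure p V \<beta> \<epsilon> \<Lambda> =
     normalized_density (reference_measure (pinned_lborel \<epsilon>) \<Lambda>)
       (\<lambda>\<phi>. exp (- hamiltonian p V \<beta> \<phi>))"

(* liminf along the finite subsets of the lattice, directed by inclusion *)
definition liminf_volume :: "(site set \<Rightarrow> real) \<Rightarrow> ereal" where
  "liminf_volume f = Liminf (finite_subsets_at_top UNIV) (\<lambda>\<Lambda>. ereal (f \<Lambda>))"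

end

(* Write the a priori measure of one site as Lebesgue measure plus a finite measure of total
   mass M (eps for delta-pinning, 2 a (exp b - 1) for the square well). Since the energy as a
   function of a single spin has second derivative at most beta c, dropping the finite part at one
   site changes the partition function by a factor of at most 1 + e with e = M sqrt (beta c).
   Hence all pinning in a box of about 1/e sites can be removed at the cost of a constant factor.
   In that box the reference measure is invariant under shifts, and a Mermin-Wagner argument
   applies: a logarithmic profile of radius 1 / sqrt e and height 1 has Dirichlet energy of order
   1 / |ln e|, so the spin at the origin can be moved by an amount of order
   sqrt (|ln e| / (beta c)) at bounded energy cost. *)

theory Submission
  imports Defs
begin

text \<open>Two one-sided comparisons make the removal of pinning cheap. The single-site law
  dominates Lebesgue measure, so the unnormalised second moment, an integral of a nonnegative
  function, only decreases when pinning is dropped; only the partition function pays the factor 1 +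
  e per site. The second moment is bounded directly, without tail estimates: with a the spin at the
  origin, (a + t)(a - t) = a^2 - t^2, so the weights shifted by t and by - t control t^2 - a^2.
  Shifting both ways cancels the first-order terms of the energy. A kernel of unbounded range is
  handled by its second moment, since the l2 norm of a difference in direction z is at most the
  number of unit steps to z times a bound for unit differences. Expectations are Bochner integrals,
  which are 0 when the second moment is infinite, so a lower bound requires finiteness first.
  Finiteness comes from exponential decay of the Boltzmann weight in every spin, for which
  irreducibility of p and the growth of a non-constant convex V are used.\<close>

subsection \<open>Dirichlet energy of the logarithmic profile\<close>

text \<open>The l2 norm on the whole group of the difference in direction z, expressed through
  finite sets so that no summability has to be carried along. The norm is used instead of its square
  because the triangle inequality then makes r additive in z.\<close>

definition shift_bounded :: "('a::ab_group_add \<Rightarrow> real) \<Rightarrow> 'a \<Rightarrow> real \<Rightarrow> bool" where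
  "shift_bounded f z r \<longleftrightarrow> (\<forall>X. finite X \<longrightarrow> L2_set (\<lambda>x. f (x + z) - f x) X \<le> r)"

lemma L2_set_translate:
  fixes z :: "'a::ab_group_add"
  shows "L2_set (\<lambda>x. g (x + z)) X = L2_set g ((\<lambda>x. x + z) ` X)"
  unfolding L2_set_def by (subst sum.reindex) (auto simp: inj_on_def)

text \<open>Telescope at x + z and use Minkowski. The second difference lives on the translate of X
  by z, which is harmless because the bounds hold for all finite sets.\<close>

lemma shift_bounded_add:
  assumes "shift_bounded f z r" "shift_bounded f w s"
  shows "shift_bounded f (z + w) (r + s)"
  unfolding shift_bounded_def
proof (intro allI impI)
  fix X :: "'a set"
  assume X: "finite X"
  have "L2_set (\<lambda>x. f (x + (z + w)) - f x) X
      = L2_set (\<lambda>x. (f (x + z) - f x) + (f (x + z + w) - f (x + z))) X"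
    by (simp add: add.assoc)
  also have "\<dots> \<le> L2_set (\<lambda>x. f (x + z) - f x) X + L2_set (\<lambda>x. f (x + z + w) - f (x + z)) X"
    by (rule L2_set_triangle_ineq)
  also have "\<dots> \<le> r + s"
    using assms X unfolding shift_bounded_def
    by (subst L2_set_translate[of "\<lambda>x. f (x + w) - f x"]) (intro add_mono; simp)
  finally show "L2_set (\<lambda>x. f (x + (z + w)) - f x) X \<le> r + s" .
qed

lemma shift_bounded_uminus:
  assumes "shift_bounded f z r"
  shows "shift_bounded f (- z) r"
  unfolding shift_bounded_def
proof (intro allI impI)
  fix X :: "'a set"
  assume X: "finite X"
  have "L2_set (\<lambda>x. f (x + - z) - f x) X = L2_set (\<lambda>x. f (x + - z + z) - f (x + - z)) X"
    by (simp add: L2_set_def power2_commute)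
  also have "\<dots> = L2_set (\<lambda>x. f (x + z) - f x) ((\<lambda>x. x + - z) ` X)"
    by (rule L2_set_translate)
  also have "\<dots> \<le> r"
    using assms X unfolding shift_bounded_def by simp
  finally show "L2_set (\<lambda>x. f (x + - z) - f x) X \<le> r" .
qed

text \<open>Here \<open>v\<close> is an additive map from the integers, in practice one of the two
  coordinate axes; one induction on the number of steps then serves both axes.\<close>

lemma shift_bounded_multiple:
  assumes "shift_bounded f (v 1) r" "r \<ge> 0"
    and v: "\<And>i j. v (i + j) = v i + v j"
  shows "shift_bounded f (v (k::int)) (\<bar>real_of_int k\<bar> * r)"
proof -
  have v0: "v 0 = 0"
    using v[of 0 0] by simp
  have nat: "shift_bounded f (v (int n)) (real n * r)" for n
  proof (induction n)
    case 0
    then show ?case by (simp add: v0 shift_bounded_def L2_set_def)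
  next
    case (Suc n)
    then show ?case
      using shift_bounded_add[OF Suc assms(1)] v[of "int n" 1] by (simp add: algebra_simps)
  qed
  have "v (- k) = - v k" for k
    using v[of k "- k"] v0 by (simp add: eq_neg_iff_add_eq_0 add.commute)
  then show ?thesis
    using nat[of "nat k"] nat[of "nat (- k)"] shift_bounded_uminus[of f "v (- k)"]
    by (cases "k \<ge> 0") auto
qed

text \<open>Reach z from the origin by unit steps along the first axis and then along the second;
  the triangle inequality charges r for each step.\<close>

lemma shift_bounded_plane:
  fixes f :: "site \<Rightarrow> real"
  assumes "shift_bounded f (1, 0) r" "shift_bounded f (0, 1) r" "r \<ge> 0"
  shows "shift_bounded f z ((\<bar>real_of_int (fst z)\<bar> + \<bar>real_of_int (snd z)\<bar>) * r)"
proof -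
  have "shift_bounded f (fst z, 0) (\<bar>real_of_int (fst z)\<bar> * r)"
    by (rule shift_bounded_multiple[where v = "\<lambda>k. (k, 0)"]) (use assms in auto)
  moreover have "shift_bounded f (0, snd z) (\<bar>real_of_int (snd z)\<bar> * r)"
    by (rule shift_bounded_multiple[where v = "\<lambda>k. (0, k)"]) (use assms in auto)
  ultimately show ?thesis
    using shift_bounded_add[of f "(fst z, 0)" _ "(0, snd z)"] by (fastforce simp: algebra_simps)
qed

lemma shift_bounded_imp_sum_le:
  assumes "shift_bounded f z r" "finite X"
  shows "(\<Sum>x\<in>X. (f (x + z) - f x)\<^sup>2) \<le> r\<^sup>2"
proof -
  have "sqrt (\<Sum>x\<in>X. (f (x + z) - f x)\<^sup>2) \<le> r"
    using assms unfolding shift_bounded_def L2_set_def by auto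
  then show ?thesis
    using sqrt_le_D by blast
qed

text \<open>Ordered pairs and no prefactor, exactly as in the sum inside \<open>hamiltonian\<close>,
  so that the two sums can be compared term by term.\<close>

definition dirichlet_energy :: "(site \<Rightarrow> real) \<Rightarrow> field_config \<Rightarrow> real" where
  "dirichlet_energy p f = (\<Sum>\<^sub>\<infinity>(x, y)\<in>UNIV. p (x - y) * (f x - f y)\<^sup>2)"

text \<open>Substituting z = x - y turns the energy into a sum over z of p z times the squared l2
  norm of the difference in direction z. Each finite set of pairs is enlarged to a rectangle, where
  the two sums separate.\<close>

lemma dirichlet_energy_le:
  assumes p: "\<And>z. p z \<ge> 0"
    and summable: "(\<lambda>(x, y). p (x - y) * (f x - f y)\<^sup>2) summable_on UNIV"
    and R: "\<And>z X. finite X \<Longrightarrow> (\<Sum>x\<in>X. (f (x + z) - f x)\<^sup>2) \<le> R z"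
    and K: "\<And>Z. finite Z \<Longrightarrow> (\<Sum>z\<in>Z. p z * R z) \<le> K"
  shows "dirichlet_energy p f \<le> K"
  unfolding dirichlet_energy_def
proof (rule infsum_le_finite_sums[OF summable])
  fix F :: "(site \<times> site) set"
  assume F: "finite F"
  define Z where "Z = (\<lambda>(x, y). x - y) ` F"
  define Y where "Y = snd ` F"
  let ?h = "\<lambda>(x :: site, y). (x - y, y)"
  have fin: "finite Z" "finite Y"
    using F by (auto simp: Z_def Y_def)
  have "inj_on ?h F"
    by (auto simp: inj_on_def)
  then have "(\<Sum>(x, y)\<in>F. p (x - y) * (f x - f y)\<^sup>2)
      = (\<Sum>(z, y)\<in>?h ` F. p z * (f (y + z) - f y)\<^sup>2)"
    by (subst sum.reindex) (auto intro!: sum.cong simp: algebra_simps)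
  also have "\<dots> \<le> (\<Sum>(z, y)\<in>Z \<times> Y. p z * (f (y + z) - f y)\<^sup>2)"
    using fin p by (intro sum_mono2) (auto simp: Z_def Y_def intro!: rev_image_eqI)
  also have "\<dots> = (\<Sum>z\<in>Z. p z * (\<Sum>y\<in>Y. (f (y + z) - f y)\<^sup>2))"
    by (simp add: sum.cartesian_product sum_distrib_left)
  also have "\<dots> \<le> (\<Sum>z\<in>Z. p z * R z)"
    using R fin p by (intro sum_mono mult_left_mono) auto
  also have "\<dots> \<le> K"
    using K fin by simp
  finally show "(\<Sum>(x, y)\<in>F. p (x - y) * (f x - f y)\<^sup>2) \<le> K" .
qed

section \<open>Boxes, shells and the logarithmic profile\<close>

definition site_box :: "nat \<Rightarrow> site set" where
  "site_box N = {- int N..int N} \<times> {- int N..int N}"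

definition sup_norm :: "site \<Rightarrow> nat" where
  "sup_norm x = nat (max \<bar>fst x\<bar> \<bar>snd x\<bar>)"

lemma mem_site_box_iff: "x \<in> site_box N \<longleftrightarrow> sup_norm x \<le> N"
  by (cases x) (auto simp: site_box_def sup_norm_def)

lemma finite_site_box [simp]: "finite (site_box N)"
  by (simp add: site_box_def)

lemma card_site_box: "card (site_box N) = (2 * N + 1)\<^sup>2"
proof -
  have "nat (int N - - int N + 1) = 2 * N + 1" by simp
  then show ?thesis
    unfolding site_box_def by (simp only: card_cartesian_product card_atLeastAtMost_int power2_eq_square)
qed

lemma sup_norm_neighbour:
  assumes "e \<in> {(1, 0), (0, 1)}"
  shows "sup_norm (x + e) \<le> Suc (sup_norm x)" "sup_norm x \<le> Suc (sup_norm (x + e))"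
  using assms by (cases x; auto simp: sup_norm_def)+

text \<open>The shell at sup-norm distance k consists of 8 k sites, each contributing 1 / k^2, so it
  adds 8 / k: the logarithmic divergence of dimension two. The origin contributes the extra 1,
  through the \<open>max\<close>.\<close>

lemma sum_site_box_inverse_square:
  "(\<Sum>x\<in>site_box N. (1 / real (max 1 (sup_norm x)))\<^sup>2) = 1 + 8 * harm N"
proof (induction N)
  case 0
  have "site_box 0 = {(0, 0)}" by (auto simp: site_box_def)
  then show ?case by (simp add: sup_norm_def harm_def)
next
  case (Suc N)
  let ?g = "\<lambda>x. (1 / real (max 1 (sup_norm x)))\<^sup>2"
  have sub: "site_box N \<subseteq> site_box (Suc N)" by (auto simp: mem_site_box_iff)
  have "sum ?g (site_box (Suc N)) = sum ?g (site_box N) + sum ?g (site_box (Suc N) - site_box N)"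
    using sum.subset_diff[OF sub, of ?g] by simp
  also have "sum ?g (site_box (Suc N) - site_box N) = (\<Sum>x\<in>site_box (Suc N) - site_box N. (1 / real (Suc N))\<^sup>2)"
    by (intro sum.cong refl) (auto simp: mem_site_box_iff le_Suc_eq)
  also have "\<dots> = real (card (site_box (Suc N)) - card (site_box N)) * (1 / real (Suc N))\<^sup>2"
    using card_Diff_subset[OF finite_site_box sub] by simp
  also have "card (site_box (Suc N)) - card (site_box N) = 8 * Suc N"
    unfolding card_site_box by (simp add: power2_eq_square algebra_simps)
  also have "real (8 * Suc N) * (1 / real (Suc N))\<^sup>2 = 8 / real (Suc N)"
  proof -
    have "8 * k * (1 / k)\<^sup>2 = 8 / k" if "k > 0" for k :: real
      using that by (simp add: power2_eq_square)
    from this[of "real (Suc N)"] show ?thesis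
      by (simp only: of_nat_mult of_nat_numeral of_nat_0_less_iff zero_less_Suc)
  qed
  finally show ?case
    using Suc by (simp add: harm_Suc inverse_eq_divide algebra_simps)
qed

text \<open>The harmonic numbers replace the logarithm of the radial Green function, so that
  the differences of consecutive values are exact.\<close>

definition log_profile :: "nat \<Rightarrow> field_config" where
  "log_profile N x = 1 - harm (min (sup_norm x) N) / harm N"

lemma log_profile_eq_0: "N > 0 \<Longrightarrow> x \<notin> site_box N \<Longrightarrow> log_profile N x = 0"
  using less_imp_neq[OF harm_pos[of N, where ?'a = real]]
  by (auto simp: log_profile_def mem_site_box_iff min_def)

lemma log_profile_origin: "log_profile N (0, 0) = 1"
  by (simp add: log_profile_def sup_norm_def harm_def)

text \<open>Here k and l are the sup norms of neighbouring sites. If k > N then l >= N, so both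
  truncated values agree and the bound is 0; the \<open>max\<close> covers k = 0, where the
  increment is at most 1.\<close>

lemma harm_step_le:
  fixes k l N :: nat
  assumes "k \<le> Suc l" "l \<le> Suc k"
  shows "\<bar>harm (min k N) - harm (min l N)\<bar> \<le> (if k \<le> N then 1 / real (max 1 k) else (0::real))"
proof -
  consider "l = k" | "l = Suc k" | "k = Suc l"
    using assms by linarith
  then show ?thesis
  proof cases
    case 2
    then have "l \<le> N \<Longrightarrow> harm l = harm k + 1 / real (Suc k)"
      by (simp add: harm_Suc inverse_eq_divide)
    moreover have "1 / real (Suc k) \<le> 1 / real (max 1 k)"
      by (intro divide_left_mono) auto
    ultimately show ?thesis
      using 2 by (cases "l \<le> N"; cases "k = N") (auto simp: min_def)
  next
    case 3
    then show ?thesis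
      by (cases "k \<le> N"; cases "l = N") (auto simp: min_def harm_Suc inverse_eq_divide)
  qed auto
qed

text \<open>With h = \<open>harm N\<close>, the increment at x is at most 1 / (h max(1, |x|)) inside
  the box and 0 outside. Summing the squares over shells gives (1 + 8 h) / h^2 <= 9 / h, because h
  >= 1; this is the origin of the 3.\<close>

lemma shift_bounded_log_profile:
  assumes N: "N > 0" and e: "e \<in> {(1, 0), (0, 1)}"
  shows "shift_bounded (log_profile N) e (3 / sqrt (harm N))"
  unfolding shift_bounded_def
proof (intro allI impI)
  fix X :: "site set"
  assume X: "finite X"
  define h :: real where "h = harm N"
  have h: "h \<ge> 1"
    unfolding h_def using harm_mono[of 1 N, where ?'a = real] N by (simp add: harm_def)
  have step: "(log_profile N (x + e) - log_profile N x)\<^sup>2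
      \<le> (if x \<in> site_box N then (1 / real (max 1 (sup_norm x)))\<^sup>2 / h\<^sup>2 else 0)" for x
  proof -
    have "\<bar>log_profile N (x + e) - log_profile N x\<bar>
        = \<bar>harm (min (sup_norm x) N) - harm (min (sup_norm (x + e)) N)\<bar> / h"
      using h by (simp add: log_profile_def h_def abs_divide flip: diff_divide_distrib)
    also have "\<dots> \<le> (if sup_norm x \<le> N then 1 / real (max 1 (sup_norm x)) else 0) / h"
      using h by (intro divide_right_mono harm_step_le sup_norm_neighbour e) auto
    finally have "(log_profile N (x + e) - log_profile N x)\<^sup>2
        \<le> ((if sup_norm x \<le> N then 1 / real (max 1 (sup_norm x)) else 0) / h)\<^sup>2"
      by (metis power_mono abs_ge_zero power2_abs)
    then show ?thesis
      by (auto simp: mem_site_box_iff power_divide split: if_splits)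
  qed
  have "(\<Sum>x\<in>X. (log_profile N (x + e) - log_profile N x)\<^sup>2)
      \<le> (\<Sum>x\<in>X. if x \<in> site_box N then (1 / real (max 1 (sup_norm x)))\<^sup>2 / h\<^sup>2 else 0)"
    by (intro sum_mono step)
  also have "\<dots> = (\<Sum>x\<in>X \<inter> site_box N. (1 / real (max 1 (sup_norm x)))\<^sup>2 / h\<^sup>2)"
    using X by (rule sum.inter_restrict[symmetric])
  also have "\<dots> \<le> (\<Sum>x\<in>site_box N. (1 / real (max 1 (sup_norm x)))\<^sup>2 / h\<^sup>2)"
    by (intro sum_mono2) auto
  also have "\<dots> = (1 + 8 * h) / h\<^sup>2"
    unfolding h_def by (simp only: sum_divide_distrib[symmetric] sum_site_box_inverse_square)
  also have "\<dots> \<le> 9 * h / h\<^sup>2"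
    using h by (intro divide_right_mono) auto
  also have "\<dots> = (3 / sqrt h)\<^sup>2"
    using h by (simp add: power_divide power2_eq_square)
  finally show "L2_set (\<lambda>x. log_profile N (x + e) - log_profile N x) X \<le> 3 / sqrt (harm N)"
    unfolding L2_set_def h_def[symmetric] using h by (intro real_le_lsqrt) (auto intro: sum_nonneg)
qed

text \<open>The factor 18 is 9 from unit steps times 2 from (|z1| + |z2|)^2 <= 2 |z|^2. The growth
  in z is quadratic, so averaging over p calls for its second moment.\<close>

lemma log_profile_translate_le:
  assumes N: "N > 0" and X: "finite X"
  shows "(\<Sum>x\<in>X. (log_profile N (x + z) - log_profile N x)\<^sup>2) \<le> 18 * (site_norm z)\<^sup>2 / harm N"
proof -
  have h: "harm N > (0::real)"
    using harm_pos[OF N] .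
  have "shift_bounded (log_profile N) z
      ((\<bar>real_of_int (fst z)\<bar> + \<bar>real_of_int (snd z)\<bar>) * (3 / sqrt (harm N)))"
    using N order_less_imp_le[OF h] by (intro shift_bounded_plane shift_bounded_log_profile) auto
  from shift_bounded_imp_sum_le[OF this X]
  have "(\<Sum>x\<in>X. (log_profile N (x + z) - log_profile N x)\<^sup>2)
      \<le> (\<bar>real_of_int (fst z)\<bar> + \<bar>real_of_int (snd z)\<bar>)\<^sup>2 * (9 / harm N)"
    using h unfolding power_mult_distrib power_divide by simp
  moreover have "(\<bar>real_of_int (fst z)\<bar> + \<bar>real_of_int (snd z)\<bar>)\<^sup>2 \<le> 2 * (site_norm z)\<^sup>2"
    using sum_squares_bound[of "\<bar>real_of_int (fst z)\<bar>" "\<bar>real_of_int (snd z)\<bar>"]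
    by (simp add: site_norm_def power2_sum)
  then have "(\<bar>real_of_int (fst z)\<bar> + \<bar>real_of_int (snd z)\<bar>)\<^sup>2 * (9 / harm N)
      \<le> 2 * (site_norm z)\<^sup>2 * (9 / harm N)"
    using order_less_imp_le[OF h] by (intro mult_right_mono) auto
  ultimately show ?thesis by simp
qed

subsection \<open>The gradient Hamiltonian\<close>

text \<open>Serves measurability of the Hamiltonian: the right side is a countable series of
  measurable functions. The identity survives divergence because \<open>infsum\<close> and
  \<open>enn2real\<close> of infinity both default to 0.\<close>

lemma infsum_eq_enn2real_suminf:
  fixes f :: "'a \<Rightarrow> real"
  assumes f: "\<And>x. 0 \<le> f x" and g: "bij_betw g (UNIV :: nat set) UNIV"
  shows "infsum f UNIV = enn2real (\<Sum>n. ennreal (f (g n)))"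
proof -
  have eq: "infsum f UNIV = (\<Sum>\<^sub>\<infinity>n. f (g n))"
    using infsum_reindex_bij_betw[OF g, of f] by simp
  show ?thesis
  proof (cases "summable (\<lambda>n. f (g n))")
    case True
    then have "((\<lambda>n. f (g n)) has_sum (\<Sum>n. f (g n))) UNIV"
      using f by (intro norm_summable_imp_has_sum) (auto simp: summable_sums)
    then show ?thesis
      using True f by (simp add: eq infsumI suminf_ennreal2 suminf_nonneg)
  next
    case False
    then have "(\<Sum>n. ennreal (f (g n))) = top"
      using f summable_suminf_not_top[of "\<lambda>n. f (g n)"] by blast
    moreover have "\<not> (\<lambda>n. f (g n)) summable_on UNIV"
      using False f by (simp add: summable_on_UNIV_nonneg_real_iff)
    ultimately show ?thesis
      by (simp add: eq infsum_not_exists)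
  qed
qed

text \<open>Average the two bounds. One quantity that controls a and controls b thereby controls
  their sum with a smaller slope, which is how the coercivity estimates are glued together.\<close>

lemma lower_bound_add:
  fixes a b h :: real
  assumes "h \<ge> k * a - K" "h \<ge> l * b - L" "a \<ge> 0" "b \<ge> 0"
  shows "h \<ge> min k l / 2 * (a + b) - (K + L) / 2"
proof -
  have "min k l * a \<le> k * a" "min k l * b \<le> l * b"
    using assms by (auto intro!: mult_right_mono)
  then have "min k l * (a + b) \<le> (h + K) + (h + L)"
    using assms unfolding distrib_left by linarith
  then show ?thesis
    by (simp add: field_simps)
qed

text \<open>\<open>V_second_difference\<close> is the integrated form of V'' <= c. In this symmetric
  form the first-order terms have already cancelled.\<close>

locale gradient_model =
  fixes p :: "site \<Rightarrow> real" and V :: "real \<Rightarrow> real" and \<beta> c :: real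
  assumes p_nonneg: "0 \<le> p z"
    and p_sum: "(p has_sum 1) UNIV"
    and p_irreducible: "irreducible_kernel p"
    and V_even: "V (- s) = V s"
    and V_convex: "convex_on UNIV V"
    and V_nonconstant: "\<exists>s. V s \<noteq> V 0"
    and V_second_difference: "V (s + h) + V (s - h) \<le> 2 * V s + c * h\<^sup>2"
    and beta_pos: "\<beta> > 0"
    and c_pos: "c > 0"
begin

lemma V_ge_V0: "V 0 \<le> V s"
  using convex_onD[OF V_convex, of "1/2" s "- s"] V_even[of s] by simp

text \<open>Choose r > 0 with V r > V 0. By convexity the chord slope over [0, r] is a lower bound
  for the slope from 0 to any point beyond r. Inside [0, r] the subtracted constant V r - V 0 makes
  the bound trivial.\<close>

lemma V_growth: "\<exists>k>0. \<exists>K. \<forall>s. V s - V 0 \<ge> k * \<bar>s\<bar> - K"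
proof -
  obtain s where s: "V s \<noteq> V 0"
    using V_nonconstant by blast
  have V_abs: "V \<bar>t\<bar> = V t" for t
    using V_even[of t] by (cases "t \<ge> 0") auto
  define r where "r = \<bar>s\<bar>"
  have r: "r > 0" "V r > V 0"
    using s V_ge_V0[of s] by (auto simp: r_def V_abs)
  have "V t - V 0 \<ge> (V r - V 0) / r * \<bar>t\<bar> - (V r - V 0)" for t
  proof (cases "\<bar>t\<bar> \<ge> r")
    case True
    then have "V (r / \<bar>t\<bar> * \<bar>t\<bar>) \<le> (1 - r / \<bar>t\<bar>) * V 0 + r / \<bar>t\<bar> * V \<bar>t\<bar>"
      using convex_onD[OF V_convex, of "r / \<bar>t\<bar>" 0 "\<bar>t\<bar>"] r by simp
    moreover have "r / \<bar>t\<bar> * \<bar>t\<bar> = r"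
      using True r by simp
    ultimately have "V r \<le> (1 - r / \<bar>t\<bar>) * V 0 + r / \<bar>t\<bar> * V t"
      by (simp only: V_abs)
    then have "V r - V 0 \<le> r / \<bar>t\<bar> * (V t - V 0)"
      unfolding left_diff_distrib right_diff_distrib by simp
    then have "(V r - V 0) / r * \<bar>t\<bar> \<le> V t - V 0"
      using True r by (simp add: field_simps)
    then show ?thesis
      using r by linarith
  next
    case False
    then have "(V r - V 0) * \<bar>t\<bar> \<le> (V r - V 0) * r"
      using r by (intro mult_left_mono) auto
    then have "(V r - V 0) / r * \<bar>t\<bar> \<le> V r - V 0"
      using r by (simp add: field_simps)
    then show ?thesis
      using V_ge_V0[of t] by linarith
  qed
  then show ?thesis
    using r by (intro exI[of _ "(V r - V 0) / r"] conjI exI[of _ "V r - V 0"]) auto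
qed

lemma V_measurable [measurable]: "V \<in> borel_measurable borel"
  using convex_on_continuous[OF open_UNIV V_convex] by (rule borel_measurable_continuous_onI)

lemma hamiltonian_measurable [measurable]:
  "hamiltonian p V \<beta> \<in> borel_measurable (\<Pi>\<^sub>M x\<in>UNIV. borel)"
proof -
  have g: "bij_betw (from_nat_into (UNIV :: (site \<times> site) set)) UNIV UNIV"
    by (rule bij_betw_from_nat_into) (auto simp: finite_prod)
  let ?t = "\<lambda>(x, y) \<phi>. p (x - y) * (V (\<phi> x - \<phi> y) - V 0)"
  have "hamiltonian p V \<beta> = (\<lambda>\<phi>. \<beta> / 2 *
      enn2real (\<Sum>n. ennreal (?t (from_nat_into (UNIV :: (site \<times> site) set) n) \<phi>)))"
    unfolding hamiltonian_def
    using p_nonneg V_ge_V0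
    by (subst infsum_eq_enn2real_suminf[OF _ g]) (auto simp: case_prod_unfold)
  also have "\<dots> \<in> borel_measurable (\<Pi>\<^sub>M x\<in>UNIV. borel)"
    unfolding case_prod_unfold by measurable
  finally show ?thesis .
qed

text \<open>Only pairs with an endpoint in A contribute, that is, finitely many rows and columns of
  p (x - y), each of total mass 1. The factor g stays bounded because a field supported in A takes
  finitely many values.\<close>

lemma pair_sum_summable:
  fixes \<phi> :: field_config and g :: "real \<Rightarrow> real"
  assumes A: "finite A" "\<And>x. x \<notin> A \<Longrightarrow> \<phi> x = 0" and g: "g 0 = 0"
  shows "(\<lambda>(x, y). p (x - y) * g (\<phi> x - \<phi> y)) summable_on (UNIV :: (site \<times> site) set)"
proof -
  have p1: "((\<lambda>y. p (x - y)) has_sum 1) UNIV" "((\<lambda>y. p (y - x)) has_sum 1) UNIV" for x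
  proof -
    have "bij_betw (\<lambda>y. x - y) UNIV UNIV"
      by (rule bij_betwI[of _ _ _ "\<lambda>y. x - y"]) auto
    moreover have "bij_betw (\<lambda>y. y - x) UNIV UNIV"
      by (rule bij_betwI[of _ _ _ "\<lambda>y. y + x"]) auto
    ultimately show "((\<lambda>y. p (x - y)) has_sum 1) UNIV" "((\<lambda>y. p (y - x)) has_sum 1) UNIV"
      using p_sum by (simp_all add: has_sum_reindex_bij_betw[where f = p])
  qed
  let ?q = "\<lambda>(x, y). p (x - y)"
  have row: "?q summable_on A \<times> UNIV"
    using A p1 p_nonneg by (intro summable_on_SigmaI[where g = "\<lambda>_. 1"]) auto
  have "(?q \<circ> prod.swap) summable_on A \<times> UNIV"
    using A p1 p_nonneg by (intro summable_on_SigmaI[where g = "\<lambda>_. 1"]) auto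
  then have "?q summable_on prod.swap ` (A \<times> UNIV)"
    by (subst summable_on_reindex) auto
  then have col: "?q summable_on (- A) \<times> A"
    by (rule summable_on_subset_banach) auto
  \<comment> \<open>All rows over A, and then the columns over A with those rows taken out, to keep
    the union disjoint.\<close>
  define S where "S = A \<times> UNIV \<union> (- A) \<times> A"
  have S: "?q summable_on S"
    unfolding S_def using row col by (rule summable_on_Un_disjoint) auto
  have "range \<phi> \<subseteq> insert 0 (\<phi> ` A)"
    using A by auto
  then have "finite (range \<phi>)"
    using A by (meson finite_imageI finite_insert finite_subset)
  then have "finite ((\<lambda>(u, v). \<bar>g (u - v)\<bar>) ` (range \<phi> \<times> range \<phi>))"
    by simp
  then obtain K where K: "\<forall>r\<in>(\<lambda>(u, v). \<bar>g (u - v)\<bar>) ` (range \<phi> \<times> range \<phi>). r \<le> K"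
    using bdd_above_finite unfolding bdd_above_def by blast
  have "(\<lambda>(x, y). p (x - y) * g (\<phi> x - \<phi> y)) summable_on S"
  proof (rule abs_summable_summable, rule summable_on_comparison_test)
    show "(\<lambda>z. K * ?q z) summable_on S"
      using S by (rule summable_on_cmult_right)
    show "norm (case z of (x, y) \<Rightarrow> p (x - y) * g (\<phi> x - \<phi> y)) \<le> K * ?q z" for z
      using K p_nonneg by (auto simp: abs_mult mult.commute[of K] intro!: mult_left_mono split: prod.split)
  qed auto
  moreover have "(\<lambda>(x, y). p (x - y) * g (\<phi> x - \<phi> y)) z = 0" if "z \<notin> S" for z
  proof -
    have "\<phi> (fst z) = 0" "\<phi> (snd z) = 0"
      using A(2)[of "fst z"] A(2)[of "snd z"] that by (auto simp: S_def mem_Times_iff)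
    then show ?thesis
      using g by (simp add: case_prod_unfold)
  qed
  ultimately show ?thesis
    by (subst summable_on_cong_neutral[where S = UNIV and T = S]) auto
qed

lemma hamiltonian_ge_pair:
  assumes "finite A" "\<And>x. x \<notin> A \<Longrightarrow> \<phi> x = 0"
  shows "hamiltonian p V \<beta> \<phi> \<ge> \<beta> / 2 * (p (x - y) * (V (\<phi> x - \<phi> y) - V 0))"
proof -
  have "(\<Sum>(x, y)\<in>{(x, y)}. p (x - y) * (V (\<phi> x - \<phi> y) - V 0))
      \<le> (\<Sum>\<^sub>\<infinity>(x, y)\<in>UNIV. p (x - y) * (V (\<phi> x - \<phi> y) - V 0))"
    using p_nonneg V_ge_V0
    by (intro finite_sum_le_infsum pair_sum_summable[OF assms, where g = "\<lambda>s. V s - V 0"]) auto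
  then show ?thesis
    unfolding hamiltonian_def using beta_pos by (intro mult_left_mono) auto
qed

text \<open>Apply \<open>V_second_difference\<close> to each pair with h = t (\<psi> x - \<psi> y);
  the remainders add up to the Dirichlet energy of \<psi>. Summability is needed for every sum
  involved, since \<open>infsum\<close> is additive and monotone only then.\<close>

lemma hamiltonian_second_difference:
  assumes A: "finite A" "\<And>x. x \<notin> A \<Longrightarrow> \<phi> x = 0" "\<And>x. x \<notin> A \<Longrightarrow> \<psi> x = 0"
    and K: "dirichlet_energy p \<psi> \<le> K"
  shows "hamiltonian p V \<beta> (\<lambda>x. \<phi> x + t * \<psi> x) + hamiltonian p V \<beta> (\<lambda>x. \<phi> x - t * \<psi> x)
    \<le> 2 * hamiltonian p V \<beta> \<phi> + \<beta> * c * t\<^sup>2 * K / 2"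
proof -
  define S where "S f = (\<Sum>\<^sub>\<infinity>(x, y)\<in>UNIV. p (x - y) * (V (f x - f y) - V 0))" for f :: field_config
  have sm: "(\<lambda>(x, y). p (x - y) * (V (f x - f y) - V 0)) summable_on UNIV"
    if "\<And>x. x \<notin> A \<Longrightarrow> f x = 0" for f :: field_config
    using pair_sum_summable[OF A(1) that, where g = "\<lambda>s. V s - V 0"] by simp
  have se: "(\<lambda>(x, y). p (x - y) * (\<psi> x - \<psi> y)\<^sup>2) summable_on UNIV"
    using pair_sum_summable[OF A(1,3), where g = "\<lambda>s. s\<^sup>2"] by simp
  let ?u = "\<lambda>x. \<phi> x + t * \<psi> x" and ?d = "\<lambda>x. \<phi> x - t * \<psi> x"
  have su: "(\<lambda>(x, y). p (x - y) * (V (?u x - ?u y) - V 0)) summable_on UNIV"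
    and sd: "(\<lambda>(x, y). p (x - y) * (V (?d x - ?d y) - V 0)) summable_on UNIV"
    and s0: "(\<lambda>(x, y). p (x - y) * (V (\<phi> x - \<phi> y) - V 0)) summable_on UNIV"
    using A by (auto intro!: sm)
  have le: "p (x - y) * (V (?u x - ?u y) - V 0) + p (x - y) * (V (?d x - ?d y) - V 0)
      \<le> 2 * (p (x - y) * (V (\<phi> x - \<phi> y) - V 0)) + c * t\<^sup>2 * (p (x - y) * (\<psi> x - \<psi> y)\<^sup>2)" for x y
  proof -
    have "V (?u x - ?u y) + V (?d x - ?d y) \<le> 2 * V (\<phi> x - \<phi> y) + c * (t * (\<psi> x - \<psi> y))\<^sup>2"
      using V_second_difference[of "\<phi> x - \<phi> y" "t * (\<psi> x - \<psi> y)"] by (simp add: algebra_simps)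
    then have "p (x - y) * (V (?u x - ?u y) + V (?d x - ?d y) - 2 * V 0)
        \<le> p (x - y) * (2 * V (\<phi> x - \<phi> y) + c * (t * (\<psi> x - \<psi> y))\<^sup>2 - 2 * V 0)"
      using p_nonneg by (intro mult_left_mono) auto
    then show ?thesis
      unfolding power_mult_distrib by (simp add: algebra_simps)
  qed
  have "S ?u + S ?d = (\<Sum>\<^sub>\<infinity>z. (\<lambda>(x, y). p (x - y) * (V (?u x - ?u y) - V 0)) z
      + (\<lambda>(x, y). p (x - y) * (V (?d x - ?d y) - V 0)) z)"
    unfolding S_def using su sd by (rule infsum_add[symmetric])
  also have "\<dots> \<le> (\<Sum>\<^sub>\<infinity>z. 2 * (\<lambda>(x, y). p (x - y) * (V (\<phi> x - \<phi> y) - V 0)) z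
      + c * t\<^sup>2 * (\<lambda>(x, y). p (x - y) * (\<psi> x - \<psi> y)\<^sup>2) z)"
    using su sd s0 se le
    by (intro infsum_mono summable_on_add summable_on_cmult_right) auto
  also have "\<dots> = 2 * S \<phi> + c * t\<^sup>2 * dirichlet_energy p \<psi>"
    unfolding S_def dirichlet_energy_def
    using s0 se by (subst infsum_add) (auto simp: summable_on_cmult_right infsum_cmult_right)
  also have "\<dots> \<le> 2 * S \<phi> + c * t\<^sup>2 * K"
    using K c_pos by (intro add_left_mono mult_left_mono) auto
  finally have "\<beta> / 2 * (S ?u + S ?d) \<le> \<beta> / 2 * (2 * S \<phi> + c * t\<^sup>2 * K)"
    using beta_pos by (intro mult_left_mono) auto
  then show ?thesis
    unfolding hamiltonian_def S_def[symmetric] by (simp add: algebra_simps)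
qed

text \<open>For each z the difference of the indicator is nonzero at x and x - z at most, and p has
  total mass 1. This controls how the energy depends on a single spin.\<close>

lemma dirichlet_energy_single_site: "dirichlet_energy p (\<lambda>y. of_bool (y = x)) \<le> 2"
proof (rule dirichlet_energy_le[where R = "\<lambda>_. 2"])
  show "(\<lambda>(y, z). p (y - z) * (of_bool (y = x) - of_bool (z = x))\<^sup>2) summable_on UNIV"
    using pair_sum_summable[of "{x}" "\<lambda>y. of_bool (y = x)" "\<lambda>s. s\<^sup>2"] by simp
next
  fix z :: site and X :: "site set"
  assume X: "finite X"
  have "(\<Sum>y\<in>X. (of_bool (y + z = x) - of_bool (y = x) :: real)\<^sup>2)
      \<le> (\<Sum>y\<in>X. (if y = x - z then 1 else 0) + (if y = x then 1 else 0))"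
    by (intro sum_mono) (auto simp: of_bool_def)
  also have "\<dots> \<le> 2"
    using X by (simp add: sum.distrib)
  finally show "(\<Sum>y\<in>X. (of_bool (y + z = x) - of_bool (y = x) :: real)\<^sup>2) \<le> 2" .
next
  fix Z :: "site set"
  assume "finite Z"
  then have "(\<Sum>z\<in>Z. p z) \<le> 1"
    using p_nonneg by (intro finite_sum_le_has_sum[OF p_sum]) auto
  then show "(\<Sum>z\<in>Z. p z * 2) \<le> 2"
    by (simp flip: sum_distrib_right)
qed (rule p_nonneg)

section \<open>Coercivity of the Hamiltonian\<close>

text \<open>Every step of the path has positive p, so by \<open>V_growth\<close> the energy controls
  the field increment along that step; the increments are added by the triangle inequality. The
  constants may depend on the path.\<close>

lemma hamiltonian_coercive_path:
  assumes A: "finite A" and w: "w 0 = 0" "\<forall>k\<in>{1..n::nat}. p (w k - w (k - 1)) > 0"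
  shows "\<exists>k>0. \<exists>K. \<forall>\<phi>. (\<forall>x. x \<notin> A \<longrightarrow> \<phi> x = 0) \<longrightarrow>
    hamiltonian p V \<beta> \<phi> \<ge> k * \<bar>\<phi> (u + w n) - \<phi> u\<bar> - K"
  using w(2)
proof (induction n)
  case 0
  have "hamiltonian p V \<beta> \<phi> \<ge> 0" if "\<forall>x. x \<notin> A \<longrightarrow> \<phi> x = 0" for \<phi>
    using hamiltonian_ge_pair[OF A, of \<phi> 0 0] that by simp
  then show ?case
    using w(1) by (intro exI[of _ 1] conjI exI[of _ 0]) auto
next
  case (Suc n)
  then have "\<exists>k>0. \<exists>K. \<forall>\<phi>. (\<forall>x. x \<notin> A \<longrightarrow> \<phi> x = 0) \<longrightarrow>
      hamiltonian p V \<beta> \<phi> \<ge> k * \<bar>\<phi> (u + w n) - \<phi> u\<bar> - K"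
    by simp
  then obtain k K where kK: "k > 0" "\<And>\<phi>. (\<forall>x. x \<notin> A \<longrightarrow> \<phi> x = 0) \<Longrightarrow>
      hamiltonian p V \<beta> \<phi> \<ge> k * \<bar>\<phi> (u + w n) - \<phi> u\<bar> - K"
    by blast
  obtain l L where lL: "l > 0" "\<And>s. V s - V 0 \<ge> l * \<bar>s\<bar> - L"
    using V_growth by blast
  define q where "q = \<beta> / 2 * p (w (Suc n) - w n)"
  have q: "q > 0"
    using Suc.prems[THEN bspec, of "Suc n"] beta_pos by (simp add: q_def)
  have "hamiltonian p V \<beta> \<phi> \<ge> min k (q * l) / 2 * \<bar>\<phi> (u + w (Suc n)) - \<phi> u\<bar> - (K + q * L) / 2"
    if \<phi>: "\<forall>x. x \<notin> A \<longrightarrow> \<phi> x = 0" for \<phi>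
  proof -
    let ?a = "\<bar>\<phi> (u + w n) - \<phi> u\<bar>" and ?b = "\<bar>\<phi> (u + w (Suc n)) - \<phi> (u + w n)\<bar>"
    have "hamiltonian p V \<beta> \<phi> \<ge> q * (V (\<phi> (u + w (Suc n)) - \<phi> (u + w n)) - V 0)"
      using hamiltonian_ge_pair[OF A, of \<phi> "u + w (Suc n)" "u + w n"] \<phi> by (simp add: q_def)
    moreover have "q * (V (\<phi> (u + w (Suc n)) - \<phi> (u + w n)) - V 0) \<ge> q * (l * ?b - L)"
      using q lL by (intro mult_left_mono) auto
    ultimately have "hamiltonian p V \<beta> \<phi> \<ge> q * l * ?b - q * L"
      by (simp add: algebra_simps)
    then have "hamiltonian p V \<beta> \<phi> \<ge> min k (q * l) / 2 * (?a + ?b) - (K + q * L) / 2"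
      using kK(2)[OF \<phi>] by (intro lower_bound_add) auto
    moreover have "min k (q * l) / 2 * (?a + ?b) \<ge> min k (q * l) / 2 * \<bar>\<phi> (u + w (Suc n)) - \<phi> u\<bar>"
      using kK q lL by (intro mult_left_mono) auto
    ultimately show ?thesis
      by linarith
  qed
  moreover have "min k (q * l) / 2 > 0"
    using kK q lL by auto
  ultimately show ?case
    by blast
qed

text \<open>Irreducibility supplies a path from u to some site outside the finite set A, where the
  field vanishes; the increment along this path is then the spin at u itself, up to sign.\<close>

lemma hamiltonian_coercive_site:
  assumes A: "finite A"
  shows "\<exists>k>0. \<exists>K. \<forall>\<phi>. (\<forall>x. x \<notin> A \<longrightarrow> \<phi> x = 0) \<longrightarrow>
    hamiltonian p V \<beta> \<phi> \<ge> k * \<bar>\<phi> u\<bar> - K"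
proof -
  have "infinite (UNIV :: site set)"
    by (simp add: finite_prod)
  then obtain y where y: "y \<notin> A"
    using A ex_new_if_finite by blast
  obtain n w where w: "w 0 = 0" "w n = y - u" "\<forall>k\<in>{1..n::nat}. p (w k - w (k - 1)) > 0"
    using p_irreducible unfolding irreducible_kernel_def by metis
  obtain k K where kK: "k > 0" "\<And>\<phi>. (\<forall>x. x \<notin> A \<longrightarrow> \<phi> x = 0) \<Longrightarrow>
      hamiltonian p V \<beta> \<phi> \<ge> k * \<bar>\<phi> (u + w n) - \<phi> u\<bar> - K"
    using hamiltonian_coercive_path[OF A w(1,3), of u] by blast
  have "hamiltonian p V \<beta> \<phi> \<ge> k * \<bar>\<phi> u\<bar> - K" if "\<forall>x. x \<notin> A \<longrightarrow> \<phi> x = 0" for \<phi>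
  proof -
    have "\<phi> (u + w n) = 0"
      using y w(2) that[rule_format, of y] by simp
    then show ?thesis
      using kK(2)[OF that] by simp
  qed
  then show ?thesis
    using kK(1) by blast
qed

lemma hamiltonian_coercive:
  assumes A: "finite A"
  shows "\<exists>k>0. \<exists>K. \<forall>\<phi>. (\<forall>x. x \<notin> A \<longrightarrow> \<phi> x = 0) \<longrightarrow>
    hamiltonian p V \<beta> \<phi> \<ge> k * (\<Sum>x\<in>A. \<bar>\<phi> x\<bar>) - K"
proof -
  \<comment> \<open>The induction runs over an auxiliary set S, while A stays fixed because it
    carries the boundary condition.\<close>
  have "\<exists>k>0. \<exists>K. \<forall>\<phi>. (\<forall>x. x \<notin> A \<longrightarrow> \<phi> x = 0) \<longrightarrow>
      hamiltonian p V \<beta> \<phi> \<ge> k * (\<Sum>x\<in>S. \<bar>\<phi> x\<bar>) - K" if "finite S" for S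
    using that
  proof (induction S rule: finite_induct)
    case empty
    have "hamiltonian p V \<beta> \<phi> \<ge> 0" if "\<forall>x. x \<notin> A \<longrightarrow> \<phi> x = 0" for \<phi>
      using hamiltonian_ge_pair[OF A, of \<phi> 0 0] that by simp
    then show ?case
      by (intro exI[of _ 1] conjI exI[of _ 0]) auto
  next
    case (insert u S)
    obtain k K where kK: "k > 0" "\<And>\<phi>. (\<forall>x. x \<notin> A \<longrightarrow> \<phi> x = 0) \<Longrightarrow>
        hamiltonian p V \<beta> \<phi> \<ge> k * (\<Sum>x\<in>S. \<bar>\<phi> x\<bar>) - K"
      using insert.IH by blast
    obtain l L where lL: "l > 0" "\<And>\<phi>. (\<forall>x. x \<notin> A \<longrightarrow> \<phi> x = 0) \<Longrightarrow>
        hamiltonian p V \<beta> \<phi> \<ge> l * \<bar>\<phi> u\<bar> - L"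
      using hamiltonian_coercive_site[OF A, of u] by blast
    have "hamiltonian p V \<beta> \<phi> \<ge> min l k / 2 * (\<Sum>x\<in>insert u S. \<bar>\<phi> x\<bar>) - (L + K) / 2"
      if "\<forall>x. x \<notin> A \<longrightarrow> \<phi> x = 0" for \<phi>
      using lower_bound_add[OF lL(2)[OF that] kK(2)[OF that]] insert.hyps by (simp add: sum_nonneg)
    moreover have "min l k / 2 > 0"
      using kK lL by auto
    ultimately show ?case
      by blast
  qed
  from this[OF A] show ?thesis .
qed

end

subsection \<open>Removing the pinning from a finite set of sites\<close>

text \<open>The map inside \<open>reference_measure\<close>, named so that integrals can be pulled
  back to the finite product.\<close>

definition extend_zero :: "site set \<Rightarrow> field_config \<Rightarrow> field_config" where
  "extend_zero \<Lambda> \<phi> = (\<lambda>x. if x \<in> \<Lambda> then \<phi> x else 0)"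

lemma extend_zero_measurable:
  assumes "\<And>x. sets (N x) = sets borel"
  shows "extend_zero \<Lambda> \<in> measurable (Pi\<^sub>M \<Lambda> N) (\<Pi>\<^sub>M x\<in>UNIV. borel)"
  unfolding extend_zero_def
proof (rule measurable_PiM_single')
  fix x
  have "(\<lambda>\<phi>. \<phi> x) \<in> measurable (Pi\<^sub>M \<Lambda> N) (N x)" if "x \<in> \<Lambda>"
    using that by measurable
  then show "(\<lambda>\<phi>. if x \<in> \<Lambda> then \<phi> x else (0::real)) \<in> measurable (Pi\<^sub>M \<Lambda> N) borel"
    by (cases "x \<in> \<Lambda>") (simp_all add: measurable_cong_sets[OF refl assms])
qed auto

text \<open>Used with a = b = 1 to compare Boltzmann weights of one spin, and with the two shifted
  values of the spin at the origin in the moment estimate.\<close>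

lemma am_gm_exp: "2 * \<bar>a * b\<bar> * exp ((u + v) / 2) \<le> a\<^sup>2 * exp u + b\<^sup>2 * exp (v::real)"
proof -
  have sq: "(exp (w / 2))\<^sup>2 = exp w" for w :: real
    by (simp add: power2_eq_square flip: exp_add)
  have "2 * (\<bar>a\<bar> * exp (u / 2)) * (\<bar>b\<bar> * exp (v / 2))
      \<le> (\<bar>a\<bar> * exp (u / 2))\<^sup>2 + (\<bar>b\<bar> * exp (v / 2))\<^sup>2"
    by (rule sum_squares_bound)
  also have "\<dots> = a\<^sup>2 * exp u + b\<^sup>2 * exp v"
    by (simp add: power_mult_distrib sq)
  also have "2 * (\<bar>a\<bar> * exp (u / 2)) * (\<bar>b\<bar> * exp (v / 2)) = 2 * \<bar>a * b\<bar> * exp ((u + v) / 2)"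
    by (simp add: abs_mult add_divide_distrib exp_add)
  finally show ?thesis .
qed

lemma nn_integral_exp_abs_finite:
  assumes "a > 0"
  shows "(\<integral>\<^sup>+u. ennreal (exp (- a * \<bar>u\<bar>)) \<partial>lborel) < \<infinity>"
proof -
  interpret prob_space "density lborel (exponential_density a)"
    using assms by (rule prob_space_exponential_density)
  let ?d = "\<lambda>u. ennreal (exponential_density a u)"
  have 1: "(\<integral>\<^sup>+u. ?d u \<partial>lborel) = 1"
    using emeasure_space_1 by (simp add: emeasure_density)
  have 2: "(\<integral>\<^sup>+u. ?d (- u) \<partial>lborel) = 1"
    using nn_integral_real_affine[of ?d "-1" 0] 1 by simp
  have "(\<integral>\<^sup>+u. ennreal (exp (- a * \<bar>u\<bar>)) \<partial>lborel)
      \<le> (\<integral>\<^sup>+u. ennreal (1 / a) * (?d u + ?d (- u)) \<partial>lborel)"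
  proof (intro nn_integral_mono)
    fix u :: real
    have "exp (- a * \<bar>u\<bar>) \<le> 1 / a * (exponential_density a u + exponential_density a (- u))"
      using assms by (auto simp: exponential_density_def mult.commute)
    then show "ennreal (exp (- a * \<bar>u\<bar>)) \<le> ennreal (1 / a) * (?d u + ?d (- u))"
      using assms exponential_density_nonneg[of a] by (simp flip: ennreal_plus ennreal_mult)
  qed
  also have "\<dots> = ennreal (1 / a) * 2"
    by (simp add: nn_integral_cmult nn_integral_add 1 2)
  also have "\<dots> < \<infinity>"
    by (simp add: ennreal_mult_less_top)
  finally show ?thesis .
qed

lemma sets_normalized_density [simp, measurable_cong]: "sets (normalized_density M f) = sets M"
  by (simp add: normalized_density_def)

text \<open>Division in \<open>ennreal\<close> is multiplication by the inverse, a constant factor,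
  so the formula also covers a normaliser equal to 0 or infinity.\<close>

lemma nn_integral_normalized_density:
  assumes [measurable]: "f \<in> borel_measurable M" "g \<in> borel_measurable M"
  shows "(\<integral>\<^sup>+x. g x \<partial>normalized_density M f)
    = (\<integral>\<^sup>+x. ennreal (f x) * g x \<partial>M) / (\<integral>\<^sup>+x. ennreal (f x) \<partial>M)"
proof -
  let ?Z = "\<integral>\<^sup>+x. ennreal (f x) \<partial>M"
  have "(\<integral>\<^sup>+x. g x \<partial>normalized_density M f) = (\<integral>\<^sup>+x. ennreal (f x) / ?Z * g x \<partial>M)"
    unfolding normalized_density_def by (rule nn_integral_density) auto
  also have "\<dots> = (\<integral>\<^sup>+x. ennreal (f x) * g x * inverse ?Z \<partial>M)"
    by (simp add: divide_ennreal_def mult_ac)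
  finally show ?thesis
    by (simp add: divide_ennreal_def nn_integral_multc)
qed

lemma sets_reference_measure [simp, measurable_cong]:
  "sets (reference_measure N \<Lambda>) = sets (\<Pi>\<^sub>M x\<in>UNIV. borel)"
  by (simp add: reference_measure_def)

lemma nn_integral_reference_measure:
  assumes "sets N = sets borel" "f \<in> borel_measurable (\<Pi>\<^sub>M x\<in>UNIV. borel)"
  shows "integral\<^sup>N (reference_measure N \<Lambda>) f = (\<integral>\<^sup>+\<phi>. f (extend_zero \<Lambda> \<phi>) \<partial>(\<Pi>\<^sub>M x\<in>\<Lambda>. N))"
  unfolding reference_measure_def extend_zero_def[symmetric]
  using assms by (intro nn_integral_distr extend_zero_measurable) auto

text \<open>Both measures agree on rectangles by Fubini. This absorbs the square-well reward into
  the single-site law, so that both kinds of pinning become a product measure weighted by the same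
  Boltzmann factor.\<close>

lemma density_PiM:
  assumes "finite I" and N: "sigma_finite_measure N" "sigma_finite_measure (density N w)"
    and w [measurable]: "w \<in> borel_measurable N"
  shows "(\<Pi>\<^sub>M i\<in>I. density N w) = density (\<Pi>\<^sub>M i\<in>I. N) (\<lambda>\<phi>. \<Prod>i\<in>I. w (\<phi> i))"
proof -
  interpret N: product_sigma_finite "\<lambda>_. N"
    by (simp add: product_sigma_finite_def N)
  interpret D: product_sigma_finite "\<lambda>_. density N w"
    by (simp add: product_sigma_finite_def N)
  have prod [measurable]: "(\<lambda>\<phi>. \<Prod>i\<in>I. w (\<phi> i)) \<in> borel_measurable (\<Pi>\<^sub>M i\<in>I. N)"
    by (intro borel_measurable_prod_ennreal measurable_compose[OF _ w] measurable_component_singleton)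
  show ?thesis
  proof (rule D.PiM_eqI[symmetric, OF \<open>finite I\<close>])
    show "sets (density (\<Pi>\<^sub>M i\<in>I. N) (\<lambda>\<phi>. \<Prod>i\<in>I. w (\<phi> i))) = sets (\<Pi>\<^sub>M i\<in>I. density N w)"
      by (auto intro!: sets_PiM_cong)
  next
    fix A
    assume "\<And>i. i \<in> I \<Longrightarrow> A i \<in> sets (density N w)"
    then have A: "\<And>i. i \<in> I \<Longrightarrow> A i \<in> sets N"
      by simp
    have "emeasure (density (\<Pi>\<^sub>M i\<in>I. N) (\<lambda>\<phi>. \<Prod>i\<in>I. w (\<phi> i))) (Pi\<^sub>E I A)
        = (\<integral>\<^sup>+\<phi>. (\<Prod>i\<in>I. w (\<phi> i)) * indicator (Pi\<^sub>E I A) \<phi> \<partial>(\<Pi>\<^sub>M i\<in>I. N))"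
      using A \<open>finite I\<close> by (intro emeasure_density prod sets_PiM_I_finite) auto
    also have "\<dots> = (\<integral>\<^sup>+\<phi>. (\<Prod>i\<in>I. w (\<phi> i) * indicator (A i) (\<phi> i)) \<partial>(\<Pi>\<^sub>M i\<in>I. N))"
    proof (rule nn_integral_cong)
      fix \<phi>
      assume "\<phi> \<in> space (\<Pi>\<^sub>M i\<in>I. N)"
      then have "indicator (Pi\<^sub>E I A) \<phi> = (\<Prod>i\<in>I. indicator (A i) (\<phi> i) :: ennreal)"
        using \<open>finite I\<close> by (auto simp: space_PiM PiE_iff indicator_def prod_zero_iff)
      then show "(\<Prod>i\<in>I. w (\<phi> i)) * indicator (Pi\<^sub>E I A) \<phi> = (\<Prod>i\<in>I. w (\<phi> i) * indicator (A i) (\<phi> i))"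
        by (simp add: prod.distrib)
    qed
    also have "\<dots> = (\<Prod>i\<in>I. \<integral>\<^sup>+u. w u * indicator (A i) u \<partial>N)"
      using A \<open>finite I\<close> by (intro N.product_nn_integral_prod) auto
    also have "\<dots> = (\<Prod>i\<in>I. emeasure (density N w) (A i))"
      using A by (intro prod.cong) (auto simp: emeasure_density)
    finally show "emeasure (density (\<Pi>\<^sub>M i\<in>I. N) (\<lambda>\<phi>. \<Prod>i\<in>I. w (\<phi> i))) (Pi\<^sub>E I A)
        = (\<Prod>i\<in>I. emeasure (density N w) (A i))" .
  qed
qed

text \<open>An integral description of m as Lebesgue measure plus a finite part of mass M:
  \<open>m_ge\<close> says that the extra part is nonnegative, \<open>m_le\<close> that it
  contributes at most M times an upper bound of the integrand.\<close>

locale pinned_model = gradient_model +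
  fixes m :: "real measure" and M :: real
  assumes sets_m [simp, measurable_cong]: "sets m = sets borel"
    and M_nonneg: "0 \<le> M"
    and m_ge: "f \<in> borel_measurable borel \<Longrightarrow> (\<integral>\<^sup>+u. f u \<partial>lborel) \<le> (\<integral>\<^sup>+u. f u \<partial>m)"
    and m_le: "f \<in> borel_measurable borel \<Longrightarrow> (\<And>u. f u \<le> K)
      \<Longrightarrow> (\<integral>\<^sup>+u. f u \<partial>m) \<le> (\<integral>\<^sup>+u. f u \<partial>lborel) + ennreal M * K"
begin

lemma space_m [simp]: "space m = UNIV"
  using sets_eq_imp_space_eq[OF sets_m] by simp

lemma sigma_finite_m: "sigma_finite_measure m"
proof
  let ?A = "range (\<lambda>n::nat. {- real n..real n})"
  have "emeasure m {- real n..real n} < \<infinity>" for n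
  proof -
    have "emeasure m {- real n..real n} = (\<integral>\<^sup>+u. indicator {- real n..real n} u \<partial>m)"
      by simp
    also have "\<dots> \<le> (\<integral>\<^sup>+u. indicator {- real n..real n} u \<partial>lborel) + ennreal M * 1"
      by (rule m_le) (auto simp: indicator_def)
    also have "\<dots> < \<infinity>"
      by simp
    finally show ?thesis .
  qed
  moreover have "\<Union>?A = UNIV"
  proof -
    have "\<exists>n. u \<in> {- real n..real n}" for u :: real
    proof -
      obtain n where "\<bar>u\<bar> \<le> real n"
        using real_arch_simple by blast
      then show ?thesis
        by (intro exI[of _ n]) auto
    qed
    then show ?thesis by blast
  qed
  ultimately show "\<exists>A. countable A \<and> A \<subseteq> sets m \<and> \<Union> A = space m \<and> (\<forall>a\<in>A. emeasure m a \<noteq> \<infinity>)"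
    by (intro exI[of _ ?A]) (auto simp: less_top)
qed

definition unpin :: "site set \<Rightarrow> site \<Rightarrow> real measure" where
  "unpin B x = (if x \<in> B then lborel else m)"

lemma sets_unpin [simp, measurable_cong]: "sets (unpin B x) = sets borel"
  by (simp add: unpin_def)

lemma space_unpin [simp]: "space (unpin B x) = UNIV"
  by (simp add: unpin_def)

lemma product_sigma_finite_unpin: "product_sigma_finite (unpin B)"
  by (simp add: product_sigma_finite_def unpin_def sigma_finite_m sigma_finite_lborel)

text \<open>Fubini in the spin at x. The outer measure is written with \<open>B - {x}\<close>, so
  that for x outside B the integrals for \<open>B\<close> and \<open>insert x B\<close> share it and
  differ only in the law of this one spin.\<close>

lemma nn_integral_unpin_site:
  assumes "finite \<Lambda>" "x \<in> \<Lambda>" "f \<in> borel_measurable (Pi\<^sub>M \<Lambda> (unpin B))"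
  shows "integral\<^sup>N (Pi\<^sub>M \<Lambda> (unpin B)) f
    = (\<integral>\<^sup>+\<phi>. (\<integral>\<^sup>+u. f (\<phi>(x := u)) \<partial>unpin B x) \<partial>(Pi\<^sub>M (\<Lambda> - {x}) (unpin (B - {x}))))"
proof -
  interpret product_sigma_finite "unpin B"
    by (rule product_sigma_finite_unpin)
  have \<Lambda>: "insert x (\<Lambda> - {x}) = \<Lambda>"
    using assms by auto
  have "Pi\<^sub>M (\<Lambda> - {x}) (unpin (B - {x})) = Pi\<^sub>M (\<Lambda> - {x}) (unpin B)"
    by (rule PiM_cong) (auto simp: unpin_def)
  then show ?thesis
    using product_nn_integral_insert[of "\<Lambda> - {x}" x f, unfolded \<Lambda>] assms by simp
qed

lemma measurable_unpin_cong:
  fixes f :: "field_config \<Rightarrow> ennreal"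
  shows "f \<in> borel_measurable (Pi\<^sub>M \<Lambda> (unpin B)) \<longleftrightarrow> f \<in> borel_measurable (Pi\<^sub>M \<Lambda> (\<lambda>_. borel))"
  using measurable_cong_sets[of "Pi\<^sub>M \<Lambda> (unpin B)" "Pi\<^sub>M \<Lambda> (\<lambda>_. borel)" borel "borel :: ennreal measure"]
    sets_PiM_cong[of \<Lambda> \<Lambda> "unpin B" "\<lambda>_. borel"] by simp

lemma update_measurable:
  assumes "f \<in> borel_measurable (Pi\<^sub>M \<Lambda> (\<lambda>_. borel))" "x \<in> \<Lambda>"
    "\<phi> \<in> space (Pi\<^sub>M (\<Lambda> - {x}) (unpin B))"
  shows "(\<lambda>u. f (\<phi>(x := u))) \<in> borel_measurable borel"
proof -
  have "(\<lambda>u. \<phi>(x := u)) \<in> measurable borel (Pi\<^sub>M (insert x (\<Lambda> - {x})) (\<lambda>_. borel))"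
    using assms(3) by (intro measurable_fun_upd[where J = "\<Lambda> - {x}"]) (auto simp: space_PiM)
  then show ?thesis
    using assms by (auto simp: insert_absorb intro: measurable_compose)
qed

definition boltzmann :: "site set \<Rightarrow> field_config \<Rightarrow> ennreal" where
  "boltzmann \<Lambda> \<phi> = ennreal (exp (- hamiltonian p V \<beta> (extend_zero \<Lambda> \<phi>)))"

lemma boltzmann_measurable [measurable]:
  "boltzmann \<Lambda> \<in> borel_measurable (Pi\<^sub>M \<Lambda> (\<lambda>_. borel))"
  unfolding boltzmann_def
  by (intro measurable_compose[OF extend_zero_measurable[of "\<lambda>_. borel"]] measurable) auto

text \<open>A weight whose logarithm has bounded concavity cannot peak sharply: its value at v is at
  most the sum of its values at v + h and v - h as long as |h| <= r. Integrating over h in [- r, r]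
  bounds the value by the Lebesgue integral divided by r.\<close>

lemma boltzmann_site_le:
  assumes \<Lambda>: "finite \<Lambda>" "x \<in> \<Lambda>" and \<phi>: "\<phi> \<in> space (Pi\<^sub>M (\<Lambda> - {x}) (unpin B))"
  shows "boltzmann \<Lambda> (\<phi>(x := v))
    \<le> ennreal (sqrt (\<beta> * c)) * (\<integral>\<^sup>+u. boltzmann \<Lambda> (\<phi>(x := u)) \<partial>lborel)"
proof -
  \<comment> \<open>The scale at which the quadratic cost beta c h^2 of moving one spin both ways
    reaches 1.\<close>
  define r where "r = 1 / sqrt (\<beta> * c)"
  have bc: "\<beta> * c > 0"
    using beta_pos c_pos by simp
  then have r: "r > 0"
    by (simp add: r_def)
  let ?G = "\<lambda>u. boltzmann \<Lambda> (\<phi>(x := u))"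
  have meas [measurable]: "?G \<in> borel_measurable borel"
    using \<Lambda> \<phi> by (intro update_measurable) auto
  have le: "?G v \<le> ?G (v + h) + ?G (v - h)" if "\<bar>h\<bar> \<le> r" for h
  proof -
    define H where "H u = hamiltonian p V \<beta> (extend_zero \<Lambda> (\<phi>(x := u)))" for u
    have ext: "(\<lambda>y. extend_zero \<Lambda> (\<phi>(x := v)) y + h * of_bool (y = x)) = extend_zero \<Lambda> (\<phi>(x := v + h))"
      "(\<lambda>y. extend_zero \<Lambda> (\<phi>(x := v)) y - h * of_bool (y = x)) = extend_zero \<Lambda> (\<phi>(x := v - h))"
      using \<Lambda> by (auto simp: extend_zero_def)
    have "H (v + h) + H (v - h) \<le> 2 * H v + \<beta> * c * h\<^sup>2 * 2 / 2"
      using hamiltonian_second_difference[OF \<Lambda>(1) _ _ dirichlet_energy_single_site,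
          of "extend_zero \<Lambda> (\<phi>(x := v))" x h] \<Lambda>
      by (simp add: ext H_def) (auto simp: extend_zero_def)
    also have "\<beta> * c * h\<^sup>2 \<le> \<beta> * c * r\<^sup>2"
      using that bc abs_le_square_iff[of h r] r by (intro mult_left_mono) auto
    also have "\<beta> * c * r\<^sup>2 = 1"
      using bc beta_pos c_pos by (simp add: r_def power_divide)
    finally have "H (v + h) + H (v - h) \<le> 2 * H v + 1"
      using bc by simp
    then have "- H v + - (1 / 2) \<le> (- H (v + h) + - H (v - h)) / 2"
      by (simp add: field_simps)
    then have "exp (- H v + - (1 / 2)) \<le> exp ((- H (v + h) + - H (v - h)) / 2)"
      by (simp only: exp_le_cancel_iff)
    then have "2 * (exp (- H v) * exp (- (1 / 2))) \<le> exp (- H (v + h)) + exp (- H (v - h))"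
      using am_gm_exp[of 1 1 "- H (v + h)" "- H (v - h)"] unfolding exp_add by simp
    \<comment> \<open>From exp(- 1/2) >= 1 - 1/2, so that the factor 2 of AM-GM absorbs the energy
      cost.\<close>
    moreover have "exp (- H v) * (1 / 2) \<le> exp (- H v) * exp (- (1 / 2))"
      using exp_ge_add_one_self[of "- (1 / 2)"] by (intro mult_left_mono) auto
    ultimately have "exp (- H v) \<le> exp (- H (v + h)) + exp (- H (v - h))"
      by linarith
    then show ?thesis
      unfolding boltzmann_def H_def[symmetric] by (simp flip: ennreal_plus)
  qed
  have "?G v * ennreal (2 * r) = (\<integral>\<^sup>+h. ?G v * indicator {- r..r} h \<partial>lborel)"
    using r by (simp add: nn_integral_cmult)
  \<comment> \<open>The bound is used for |h| <= r and the integral is then extended to the line;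
    translation and reflection turn both terms into the same integral.\<close>
  also have "\<dots> \<le> (\<integral>\<^sup>+h. ?G (v + h) + ?G (v - h) \<partial>lborel)"
    using le by (intro nn_integral_mono) (auto simp: indicator_def abs_le_iff)
  also have "\<dots> = (\<integral>\<^sup>+h. ?G (v + h) \<partial>lborel) + (\<integral>\<^sup>+h. ?G (v - h) \<partial>lborel)"
    by (rule nn_integral_add) auto
  also have "\<dots> = 2 * (\<integral>\<^sup>+u. ?G u \<partial>lborel)"
    using nn_integral_real_affine[of ?G 1 v] nn_integral_real_affine[of ?G "-1" v]
    by (simp add: mult_2)
  finally have "?G v * ennreal (2 * r) * ennreal (1 / (2 * r))
      \<le> 2 * (\<integral>\<^sup>+u. ?G u \<partial>lborel) * ennreal (1 / (2 * r))"
    by (rule mult_right_mono) simp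
  then have "?G v * (ennreal (2 * r) * ennreal (1 / (2 * r)))
      \<le> 2 * ennreal (1 / (2 * r)) * (\<integral>\<^sup>+u. ?G u \<partial>lborel)"
    by (simp only: mult.assoc mult.commute[of "ennreal (1 / (2 * r))"])
  moreover have "ennreal (2 * r) * ennreal (1 / (2 * r)) = 1"
    using r by (simp flip: ennreal_mult)
  moreover have "2 * ennreal (1 / (2 * r)) = ennreal (sqrt (\<beta> * c))"
  proof -
    have "2 * ennreal (1 / (2 * r)) = ennreal (2 * (1 / (2 * r)))"
      using r by (subst ennreal_mult) auto
    then show ?thesis
      using bc by (simp add: r_def)
  qed
  ultimately show ?thesis
    by simp
qed

text \<open>The finite part contributes at most M times the supremum over the spin at x, and
  \<open>boltzmann_site_le\<close> bounds that supremum by the Lebesgue integral itself, so the loss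
  is multiplicative and uniform in all other spins.\<close>

lemma partition_unpin_site:
  assumes "finite \<Lambda>" "x \<in> \<Lambda>" "x \<notin> B"
  shows "(\<integral>\<^sup>+\<phi>. boltzmann \<Lambda> \<phi> \<partial>(Pi\<^sub>M \<Lambda> (unpin B)))
    \<le> ennreal (1 + M * sqrt (\<beta> * c)) * (\<integral>\<^sup>+\<phi>. boltzmann \<Lambda> \<phi> \<partial>(Pi\<^sub>M \<Lambda> (unpin (insert x B))))"
proof -
  have bc: "sqrt (\<beta> * c) \<ge> 0"
    using beta_pos c_pos by simp
  have Z: "(\<integral>\<^sup>+\<phi>. boltzmann \<Lambda> \<phi> \<partial>(Pi\<^sub>M \<Lambda> (unpin A)))
    = (\<integral>\<^sup>+\<phi>. (\<integral>\<^sup>+u. boltzmann \<Lambda> (\<phi>(x := u)) \<partial>unpin A x) \<partial>(Pi\<^sub>M (\<Lambda> - {x}) (unpin (A - {x}))))" for A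
    using assms by (intro nn_integral_unpin_site) (auto simp: measurable_unpin_cong)
  have "(\<integral>\<^sup>+\<phi>. boltzmann \<Lambda> \<phi> \<partial>(Pi\<^sub>M \<Lambda> (unpin B)))
      = (\<integral>\<^sup>+\<phi>. (\<integral>\<^sup>+u. boltzmann \<Lambda> (\<phi>(x := u)) \<partial>m) \<partial>(Pi\<^sub>M (\<Lambda> - {x}) (unpin B)))"
    using Z[of B] assms by (simp add: unpin_def)
  also have "\<dots> \<le> (\<integral>\<^sup>+\<phi>. ennreal (1 + M * sqrt (\<beta> * c))
      * (\<integral>\<^sup>+u. boltzmann \<Lambda> (\<phi>(x := u)) \<partial>lborel) \<partial>(Pi\<^sub>M (\<Lambda> - {x}) (unpin B)))"
  proof (rule nn_integral_mono)
    fix \<phi>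
    assume \<phi>: "\<phi> \<in> space (Pi\<^sub>M (\<Lambda> - {x}) (unpin B))"
    let ?I = "\<integral>\<^sup>+u. boltzmann \<Lambda> (\<phi>(x := u)) \<partial>lborel"
    have "(\<integral>\<^sup>+u. boltzmann \<Lambda> (\<phi>(x := u)) \<partial>m) \<le> ?I + ennreal M * (ennreal (sqrt (\<beta> * c)) * ?I)"
      using assms \<phi> by (intro m_le boltzmann_site_le update_measurable) auto
    also have "\<dots> = ennreal (1 + M * sqrt (\<beta> * c)) * ?I"
      using M_nonneg bc by (simp add: ennreal_mult distrib_right mult.assoc)
    finally show "(\<integral>\<^sup>+u. boltzmann \<Lambda> (\<phi>(x := u)) \<partial>m) \<le> ennreal (1 + M * sqrt (\<beta> * c)) * ?I" .
  qed
  also have "\<dots> = ennreal (1 + M * sqrt (\<beta> * c))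
      * (\<integral>\<^sup>+\<phi>. (\<integral>\<^sup>+u. boltzmann \<Lambda> (\<phi>(x := u)) \<partial>lborel) \<partial>(Pi\<^sub>M (\<Lambda> - {x}) (unpin B)))"
  proof (rule nn_integral_cmult)
    have "(\<lambda>(\<phi>, u). boltzmann \<Lambda> (\<phi>(x := u))) \<in>
        borel_measurable (Pi\<^sub>M (\<Lambda> - {x}) (unpin B) \<Otimes>\<^sub>M lborel)"
    proof -
      have "(\<lambda>(\<phi>, u). \<phi>(x := u)) \<in> measurable (Pi\<^sub>M (\<Lambda> - {x}) (unpin B) \<Otimes>\<^sub>M unpin B x)
          (Pi\<^sub>M (insert x (\<Lambda> - {x})) (unpin B))"
        by (rule measurable_add_dim)
      moreover have "boltzmann \<Lambda> \<in> borel_measurable (Pi\<^sub>M (insert x (\<Lambda> - {x})) (unpin B))"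
        using assms by (simp add: insert_absorb measurable_unpin_cong)
      moreover have "sets (Pi\<^sub>M (\<Lambda> - {x}) (unpin B) \<Otimes>\<^sub>M unpin B x) = sets (Pi\<^sub>M (\<Lambda> - {x}) (unpin B) \<Otimes>\<^sub>M lborel)"
        by (rule sets_pair_measure_cong) auto
      ultimately show ?thesis
        by (subst measurable_cong_sets[OF _ refl, of _ "Pi\<^sub>M (\<Lambda> - {x}) (unpin B) \<Otimes>\<^sub>M unpin B x"])
           (auto simp: case_prod_unfold intro: measurable_compose)
    qed
    then show "(\<lambda>\<phi>. \<integral>\<^sup>+u. boltzmann \<Lambda> (\<phi>(x := u)) \<partial>lborel) \<in> borel_measurable (Pi\<^sub>M (\<Lambda> - {x}) (unpin B))"
      by (rule lborel.borel_measurable_nn_integral)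
  qed
  also have "(\<integral>\<^sup>+\<phi>. (\<integral>\<^sup>+u. boltzmann \<Lambda> (\<phi>(x := u)) \<partial>lborel) \<partial>(Pi\<^sub>M (\<Lambda> - {x}) (unpin B)))
      = (\<integral>\<^sup>+\<phi>. boltzmann \<Lambda> \<phi> \<partial>(Pi\<^sub>M \<Lambda> (unpin (insert x B))))"
    using Z[of "insert x B"] assms by (simp add: unpin_def[of _ x])
  finally show ?thesis .
qed

text \<open>Domination by m gives the opposite comparison at no cost, for every nonnegative
  integrand; it is applied to the second moment.\<close>

lemma nn_integral_unpin_insert_le:
  assumes "finite \<Lambda>" "x \<in> \<Lambda>" "x \<notin> B" and f: "f \<in> borel_measurable (Pi\<^sub>M \<Lambda> (\<lambda>_. borel))"
  shows "integral\<^sup>N (Pi\<^sub>M \<Lambda> (unpin (insert x B))) f \<le> integral\<^sup>N (Pi\<^sub>M \<Lambda> (unpin B)) f"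
proof -
  have I: "integral\<^sup>N (Pi\<^sub>M \<Lambda> (unpin A)) f
    = (\<integral>\<^sup>+\<phi>. (\<integral>\<^sup>+u. f (\<phi>(x := u)) \<partial>unpin A x) \<partial>(Pi\<^sub>M (\<Lambda> - {x}) (unpin (A - {x}))))" for A
    using assms by (intro nn_integral_unpin_site) (auto simp: measurable_unpin_cong)
  have "(\<integral>\<^sup>+\<phi>. (\<integral>\<^sup>+u. f (\<phi>(x := u)) \<partial>lborel) \<partial>(Pi\<^sub>M (\<Lambda> - {x}) (unpin B)))
      \<le> (\<integral>\<^sup>+\<phi>. (\<integral>\<^sup>+u. f (\<phi>(x := u)) \<partial>m) \<partial>(Pi\<^sub>M (\<Lambda> - {x}) (unpin B)))"
    using assms by (intro nn_integral_mono m_ge update_measurable) auto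
  then show ?thesis
    using I[of B] I[of "insert x B"] assms by (simp add: unpin_def[of _ x])
qed

lemma partition_unpin:
  assumes \<Lambda>: "finite \<Lambda>" "B \<subseteq> \<Lambda>"
  shows "(\<integral>\<^sup>+\<phi>. boltzmann \<Lambda> \<phi> \<partial>(Pi\<^sub>M \<Lambda> (\<lambda>_. m)))
    \<le> ennreal (1 + M * sqrt (\<beta> * c)) ^ card B * (\<integral>\<^sup>+\<phi>. boltzmann \<Lambda> \<phi> \<partial>(Pi\<^sub>M \<Lambda> (unpin B)))"
  using finite_subset[OF \<Lambda>(2,1)] \<Lambda>(2)
proof (induction B rule: finite_induct)
  case empty
  then show ?case by (simp add: unpin_def)
next
  case (insert x B)
  have "(\<integral>\<^sup>+\<phi>. boltzmann \<Lambda> \<phi> \<partial>(Pi\<^sub>M \<Lambda> (\<lambda>_. m)))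
      \<le> ennreal (1 + M * sqrt (\<beta> * c)) ^ card B * (\<integral>\<^sup>+\<phi>. boltzmann \<Lambda> \<phi> \<partial>(Pi\<^sub>M \<Lambda> (unpin B)))"
    using insert by simp
  also have "\<dots> \<le> ennreal (1 + M * sqrt (\<beta> * c)) ^ card B *
      (ennreal (1 + M * sqrt (\<beta> * c)) * (\<integral>\<^sup>+\<phi>. boltzmann \<Lambda> \<phi> \<partial>(Pi\<^sub>M \<Lambda> (unpin (insert x B)))))"
    using insert \<Lambda> by (intro mult_left_mono partition_unpin_site) auto
  finally show ?case
    using insert.hyps by (simp add: mult.assoc mult.left_commute)
qed

lemma nn_integral_unpin_le:
  assumes \<Lambda>: "finite \<Lambda>" "B \<subseteq> \<Lambda>" and f: "f \<in> borel_measurable (Pi\<^sub>M \<Lambda> (\<lambda>_. borel))"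
  shows "integral\<^sup>N (Pi\<^sub>M \<Lambda> (unpin B)) f \<le> integral\<^sup>N (Pi\<^sub>M \<Lambda> (\<lambda>_. m)) f"
  using finite_subset[OF \<Lambda>(2,1)] \<Lambda>(2)
proof (induction B rule: finite_induct)
  case empty
  then show ?case by (simp add: unpin_def)
next
  case (insert x B)
  then show ?case
    using nn_integral_unpin_insert_le[of \<Lambda> x B f] \<Lambda>(1) f by auto
qed

text \<open>A shift supported in B moves only spins with Lebesgue law; all other spins, including
  the pinned ones, stay fixed. Checking rectangles therefore reduces to translation invariance on
  the line.\<close>

lemma nn_integral_unpin_shift:
  assumes \<Lambda>: "finite \<Lambda>" and s: "\<And>x. x \<notin> B \<Longrightarrow> s x = 0"
    and f: "f \<in> borel_measurable (Pi\<^sub>M \<Lambda> (\<lambda>_. borel))"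
  shows "(\<integral>\<^sup>+\<phi>. f (\<lambda>x\<in>\<Lambda>. \<phi> x + s x) \<partial>(Pi\<^sub>M \<Lambda> (unpin B))) = integral\<^sup>N (Pi\<^sub>M \<Lambda> (unpin B)) f"
proof -
  interpret product_sigma_finite "unpin B"
    by (rule product_sigma_finite_unpin)
  let ?P = "Pi\<^sub>M \<Lambda> (unpin B)" and ?T = "\<lambda>\<phi>. \<lambda>x\<in>\<Lambda>. \<phi> x + s x"
  have T [measurable]: "?T \<in> measurable ?P ?P"
    by (intro measurable_restrict) (simp add: measurable_cong_sets[OF refl sets_unpin])
  have site: "emeasure (unpin B x) ((\<lambda>u. u + s x) -` A) = emeasure (unpin B x) A"
    if "A \<in> sets borel" for A x
  proof (cases "x \<in> B")
    case True
    have "emeasure lborel A = emeasure (distr lborel borel ((+) (s x))) A"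
      by (simp add: lborel_distr_plus)
    also have "\<dots> = emeasure lborel ((+) (s x) -` A)"
      using that by (subst emeasure_distr) auto
    finally show ?thesis
      using True by (simp add: unpin_def add.commute vimage_def)
  qed (simp add: s)
  have "distr ?P ?P ?T = ?P"
  proof (rule PiM_eqI[OF \<Lambda>])
    fix A
    assume A: "\<And>x. x \<in> \<Lambda> \<Longrightarrow> A x \<in> sets (unpin B x)"
    have "emeasure (distr ?P ?P ?T) (Pi\<^sub>E \<Lambda> A) = emeasure ?P (?T -` Pi\<^sub>E \<Lambda> A \<inter> space ?P)"
      using A \<Lambda> by (intro emeasure_distr T sets_PiM_I_finite) auto
    also have "?T -` Pi\<^sub>E \<Lambda> A \<inter> space ?P = Pi\<^sub>E \<Lambda> (\<lambda>x. (\<lambda>u. u + s x) -` A x)"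
      by (auto simp: space_PiM PiE_def Pi_def)
    also have "emeasure ?P \<dots> = (\<Prod>x\<in>\<Lambda>. emeasure (unpin B x) ((\<lambda>u. u + s x) -` A x))"
    proof (rule emeasure_PiM[OF \<Lambda>])
      fix x
      assume "x \<in> \<Lambda>"
      then have "(\<lambda>u. u + s x) -` A x \<inter> space borel \<in> sets borel"
        using A by (intro measurable_sets[of _ borel borel]) auto
      then show "(\<lambda>u. u + s x) -` A x \<in> sets (unpin B x)"
        by simp
    qed
    also have "\<dots> = (\<Prod>x\<in>\<Lambda>. emeasure (unpin B x) (A x))"
      using A by (intro prod.cong site) auto
    finally show "emeasure (distr ?P ?P ?T) (Pi\<^sub>E \<Lambda> A) = (\<Prod>x\<in>\<Lambda>. emeasure (unpin B x) (A x))" .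
  qed simp
  then have "integral\<^sup>N ?P f = integral\<^sup>N (distr ?P ?P ?T) f"
    by simp
  also have "\<dots> = (\<integral>\<^sup>+\<phi>. f (?T \<phi>) \<partial>?P)"
    using f by (intro nn_integral_distr T) (simp add: measurable_unpin_cong)
  finally show ?thesis
    by simp
qed

subsection \<open>Fluctuations of the spin at the origin\<close>

definition moment_weight :: "site set \<Rightarrow> field_config \<Rightarrow> ennreal" where
  "moment_weight \<Lambda> \<phi> = ennreal ((extend_zero \<Lambda> \<phi> (0, 0))\<^sup>2) * boltzmann \<Lambda> \<phi>"

lemma moment_weight_measurable [measurable]:
  "moment_weight \<Lambda> \<in> borel_measurable (Pi\<^sub>M \<Lambda> (\<lambda>_. borel))"
proof -
  have [measurable]: "(\<lambda>\<phi>. extend_zero \<Lambda> \<phi> (0, 0)) \<in> borel_measurable (Pi\<^sub>M \<Lambda> (\<lambda>_. borel))"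
    by (rule measurable_compose[OF extend_zero_measurable measurable_component_singleton]) auto
  show ?thesis
    unfolding moment_weight_def by measurable
qed

text \<open>The shifts by t and -t times the profile cost at most 2 in total energy, so AM-GM for the two
  shifted weights controls the distance of the squared spin at the origin from the square of t,
  weighted by the unshifted Boltzmann factor.\<close>

lemma boltzmann_le_moment_weight:
  assumes \<Lambda>: "finite \<Lambda>" "(0, 0) \<in> \<Lambda>" and \<psi>: "\<And>x. x \<notin> \<Lambda> \<Longrightarrow> \<psi> x = 0" "\<psi> (0, 0) = 1"
    and K: "dirichlet_energy p \<psi> \<le> K" and t: "\<beta> * c * t\<^sup>2 * K = 4"
  shows "ennreal (t\<^sup>2) * boltzmann \<Lambda> \<phi> \<le> moment_weight \<Lambda> \<phi> + ennreal (exp 1 / 2) *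
    (moment_weight \<Lambda> (\<lambda>x\<in>\<Lambda>. \<phi> x + t * \<psi> x) + moment_weight \<Lambda> (\<lambda>x\<in>\<Lambda>. \<phi> x + - t * \<psi> x))"
proof -
  define H where "H s = hamiltonian p V \<beta> (extend_zero \<Lambda> (\<lambda>x\<in>\<Lambda>. \<phi> x + s * \<psi> x))" for s
  have H0: "hamiltonian p V \<beta> (extend_zero \<Lambda> \<phi>) = H 0"
    unfolding H_def by (rule arg_cong[where f = "hamiltonian p V \<beta>"]) (auto simp: extend_zero_def)
  have ext: "(\<lambda>x. extend_zero \<Lambda> \<phi> x + t * \<psi> x) = extend_zero \<Lambda> (\<lambda>x\<in>\<Lambda>. \<phi> x + t * \<psi> x)"
    "(\<lambda>x. extend_zero \<Lambda> \<phi> x - t * \<psi> x) = extend_zero \<Lambda> (\<lambda>x\<in>\<Lambda>. \<phi> x + - t * \<psi> x)"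
    using \<psi>(1) by (auto simp: extend_zero_def)
  have "H t + H (- t) \<le> 2 * H 0 + \<beta> * c * t\<^sup>2 * K / 2"
    using hamiltonian_second_difference[OF \<Lambda>(1) _ \<psi>(1) K, of "extend_zero \<Lambda> \<phi>" t]
    unfolding ext H0 H_def by (simp add: extend_zero_def)
  then have H: "- H 0 \<le> 1 + (- H t + - H (- t)) / 2"
    using t by (simp add: field_simps)
  define a where "a = \<phi> (0, 0)"
  define E where "E = exp ((- H t + - H (- t)) / 2)"
  have "\<bar>(a + t) * (a + - t)\<bar> * exp (- H 0) \<le> \<bar>(a + t) * (a + - t)\<bar> * (exp 1 * E)"
    using H unfolding E_def exp_add[symmetric] by (intro mult_left_mono) auto
  also have "\<dots> = exp 1 / 2 * (2 * \<bar>(a + t) * (a + - t)\<bar> * E)"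
    by simp
  also have "\<dots> \<le> exp 1 / 2 * ((a + t)\<^sup>2 * exp (- H t) + (a + - t)\<^sup>2 * exp (- H (- t)))"
    unfolding E_def by (intro mult_left_mono am_gm_exp) auto
  finally have shifted: "\<bar>(a + t) * (a + - t)\<bar> * exp (- H 0)
      \<le> exp 1 / 2 * ((a + t)\<^sup>2 * exp (- H t) + (a + - t)\<^sup>2 * exp (- H (- t)))" .
  \<comment> \<open>The product is a^2 - t^2, so this is the triangle inequality.\<close>
  have "t\<^sup>2 \<le> a\<^sup>2 + \<bar>(a + t) * (a + - t)\<bar>"
    by (simp add: algebra_simps power2_eq_square)
  then have "t\<^sup>2 * exp (- H 0) \<le> a\<^sup>2 * exp (- H 0) + \<bar>(a + t) * (a + - t)\<bar> * exp (- H 0)"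
    unfolding distrib_right[symmetric] by (intro mult_right_mono) auto
  then have le: "t\<^sup>2 * exp (- H 0) \<le> a\<^sup>2 * exp (- H 0)
      + exp 1 / 2 * ((a + t)\<^sup>2 * exp (- H t) + (a + - t)\<^sup>2 * exp (- H (- t)))"
    using shifted by linarith
  have w: "moment_weight \<Lambda> (\<lambda>x\<in>\<Lambda>. \<phi> x + s * \<psi> x) = ennreal ((a + s)\<^sup>2 * exp (- H s))" for s
    using \<Lambda>(2) \<psi>(2)
    by (simp add: moment_weight_def boltzmann_def ennreal_mult flip: H_def)
       (simp add: extend_zero_def a_def)
  have w0: "moment_weight \<Lambda> \<phi> = ennreal (a\<^sup>2 * exp (- H 0))"
    using \<Lambda>(2) by (simp add: moment_weight_def boltzmann_def H0 ennreal_mult)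
       (simp add: extend_zero_def a_def)
  have b: "ennreal (t\<^sup>2) * boltzmann \<Lambda> \<phi> = ennreal (t\<^sup>2 * exp (- H 0))"
    by (simp add: boltzmann_def H0 ennreal_mult)
  show ?thesis
    unfolding w w0 b using le by (simp flip: ennreal_plus ennreal_mult)
qed

text \<open>Integrate the pointwise estimate. By shift invariance the unshifted and both shifted
  terms have the same integral, which yields 1 + 2 (exp 1 / 2) = 1 + exp 1.\<close>

lemma unpinned_moment:
  assumes \<Lambda>: "finite \<Lambda>" "B \<subseteq> \<Lambda>" "(0, 0) \<in> B" and \<psi>: "\<And>x. x \<notin> B \<Longrightarrow> \<psi> x = 0" "\<psi> (0, 0) = 1"
    and K: "dirichlet_energy p \<psi> \<le> K" "K > 0"
  shows "ennreal (4 / (\<beta> * c * K)) * (\<integral>\<^sup>+\<phi>. boltzmann \<Lambda> \<phi> \<partial>(Pi\<^sub>M \<Lambda> (unpin B)))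
    \<le> ennreal (1 + exp 1) * (\<integral>\<^sup>+\<phi>. moment_weight \<Lambda> \<phi> \<partial>(Pi\<^sub>M \<Lambda> (unpin B)))"
proof -
  \<comment> \<open>Chosen so that the total cost beta c t^2 K / 2 of the two shifts equals
    2.\<close>
  define t where "t = sqrt (4 / (\<beta> * c * K))"
  have bc: "\<beta> * c * K > 0"
    using beta_pos c_pos K by simp
  then have t2: "t\<^sup>2 = 4 / (\<beta> * c * K)"
    by (simp add: t_def)
  then have t: "\<beta> * c * t\<^sup>2 * K = 4"
    using beta_pos c_pos K by simp
  let ?P = "Pi\<^sub>M \<Lambda> (unpin B)"
  let ?up = "\<lambda>\<phi>. moment_weight \<Lambda> (\<lambda>x\<in>\<Lambda>. \<phi> x + t * \<psi> x)"
  let ?down = "\<lambda>\<phi>. moment_weight \<Lambda> (\<lambda>x\<in>\<Lambda>. \<phi> x + - t * \<psi> x)"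
  have linear: "(\<integral>\<^sup>+\<phi>. f \<phi> + a * (g \<phi> + h \<phi>) \<partial>?P)
      = integral\<^sup>N ?P f + a * (integral\<^sup>N ?P g + integral\<^sup>N ?P h)"
    if "f \<in> borel_measurable ?P" "g \<in> borel_measurable ?P" "h \<in> borel_measurable ?P" for f g h a
    using that by (simp add: nn_integral_add nn_integral_cmult)
  have boltzmann: "boltzmann \<Lambda> \<in> borel_measurable ?P" and moment: "moment_weight \<Lambda> \<in> borel_measurable ?P"
    by (simp_all add: measurable_unpin_cong)
  have shift: "(\<lambda>\<phi>. moment_weight \<Lambda> (\<lambda>x\<in>\<Lambda>. \<phi> x + s * \<psi> x)) \<in> borel_measurable ?P" for s
  proof -
    have "(\<lambda>\<phi>. \<lambda>x\<in>\<Lambda>. \<phi> x + s * \<psi> x) \<in> measurable ?P ?P"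
      by (intro measurable_restrict) (simp add: measurable_cong_sets[OF refl sets_unpin])
    then show ?thesis
      using moment by (rule measurable_compose)
  qed
  have shift_eq: "(\<integral>\<^sup>+\<phi>. moment_weight \<Lambda> (\<lambda>x\<in>\<Lambda>. \<phi> x + s * \<psi> x) \<partial>?P) = integral\<^sup>N ?P (moment_weight \<Lambda>)" for s
    using \<Lambda> \<psi> by (intro nn_integral_unpin_shift) auto
  have "ennreal (t\<^sup>2) * integral\<^sup>N ?P (boltzmann \<Lambda>) = (\<integral>\<^sup>+\<phi>. ennreal (t\<^sup>2) * boltzmann \<Lambda> \<phi> \<partial>?P)"
    by (rule nn_integral_cmult[symmetric, OF boltzmann])
  also have "\<dots> \<le> (\<integral>\<^sup>+\<phi>. moment_weight \<Lambda> \<phi> + ennreal (exp 1 / 2) * (?up \<phi> + ?down \<phi>) \<partial>?P)"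
    using \<Lambda> \<psi> K t by (intro nn_integral_mono boltzmann_le_moment_weight) auto
  also have "\<dots> = integral\<^sup>N ?P (moment_weight \<Lambda>) + ennreal (exp 1 / 2) *
      (integral\<^sup>N ?P (moment_weight \<Lambda>) + integral\<^sup>N ?P (moment_weight \<Lambda>))"
    by (subst linear[OF _ shift shift]) (auto simp only: shift_eq moment)
  also have "\<dots> = (1 + ennreal (exp 1 / 2) * 2) * integral\<^sup>N ?P (moment_weight \<Lambda>)"
    by (simp add: distrib_right distrib_left mult_2 mult.assoc)
  also have "1 + ennreal (exp 1 / 2) * 2 = ennreal (1 + exp 1)"
  proof -
    have "ennreal (exp 1 / 2) * 2 = ennreal (exp 1 / 2 * 2)"
      by (subst ennreal_mult) auto
    then show ?thesis
      by (simp add: ennreal_plus)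
  qed
  finally show ?thesis
    unfolding t2 .
qed

text \<open>Removing the pinning from B costs at most (1 + M sqrt(beta c))^|B| <= exp q in the
  partition function, and nothing in the moment. The product form, in place of a quotient, does not
  presuppose a finite partition function.\<close>

lemma moment_lower_bound:
  assumes \<Lambda>: "finite \<Lambda>" "B \<subseteq> \<Lambda>" "(0, 0) \<in> B" and \<psi>: "\<And>x. x \<notin> B \<Longrightarrow> \<psi> x = 0" "\<psi> (0, 0) = 1"
    and K: "dirichlet_energy p \<psi> \<le> K" "K > 0"
    and B: "M * sqrt (\<beta> * c) * card B \<le> q"
  shows "ennreal (4 / (\<beta> * c * K) / (exp q * (1 + exp 1)))
      * (\<integral>\<^sup>+\<phi>. boltzmann \<Lambda> \<phi> \<partial>(Pi\<^sub>M \<Lambda> (\<lambda>_. m)))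
    \<le> (\<integral>\<^sup>+\<phi>. moment_weight \<Lambda> \<phi> \<partial>(Pi\<^sub>M \<Lambda> (\<lambda>_. m)))"
proof -
  let ?Z = "\<integral>\<^sup>+\<phi>. boltzmann \<Lambda> \<phi> \<partial>(Pi\<^sub>M \<Lambda> (\<lambda>_. m))"
  let ?ZB = "\<integral>\<^sup>+\<phi>. boltzmann \<Lambda> \<phi> \<partial>(Pi\<^sub>M \<Lambda> (unpin B))"
  let ?A = "\<integral>\<^sup>+\<phi>. moment_weight \<Lambda> \<phi> \<partial>(Pi\<^sub>M \<Lambda> (\<lambda>_. m))"
  define k where "k = 4 / (\<beta> * c * K)"
  define d where "d = exp q * (1 + exp (1::real))"
  have k: "k \<ge> 0"
    using beta_pos c_pos K by (simp add: k_def)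
  have d: "d > 0"
    by (simp add: d_def add_pos_pos)
  have e: "0 \<le> M * sqrt (\<beta> * c)"
    using M_nonneg beta_pos c_pos by simp
  have "(1 + M * sqrt (\<beta> * c)) ^ card B \<le> exp (M * sqrt (\<beta> * c)) ^ card B"
    using e exp_ge_add_one_self by (intro power_mono) auto
  also have "\<dots> = exp (M * sqrt (\<beta> * c) * card B)"
    by (simp add: exp_of_nat_mult[symmetric] mult.commute)
  also have "\<dots> \<le> exp q"
    using B by simp
  finally have pow: "ennreal (1 + M * sqrt (\<beta> * c)) ^ card B \<le> ennreal (exp q)"
    using e by (subst ennreal_power) (auto intro: ennreal_leI)
  have "?Z \<le> ennreal (exp q) * ?ZB"
    using partition_unpin[OF \<Lambda>(1,2)] mult_right_mono[OF pow, of ?ZB] by (auto intro: order_trans)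
  then have "ennreal k * ?Z \<le> ennreal k * (ennreal (exp q) * ?ZB)"
    by (rule mult_left_mono) simp
  also have "\<dots> = ennreal (exp q) * (ennreal k * ?ZB)"
    by (simp add: mult.left_commute)
  also have "\<dots> \<le> ennreal (exp q) * (ennreal (1 + exp 1) * ?A)"
    unfolding k_def
    by (intro mult_left_mono order_trans[OF unpinned_moment[OF \<Lambda> \<psi> K]]
      nn_integral_unpin_le[OF \<Lambda>(1,2) moment_weight_measurable]) auto
  also have "\<dots> = ennreal d * ?A"
    by (simp add: d_def ennreal_mult mult.assoc add_nonneg_nonneg)
  finally have "ennreal (1 / d) * (ennreal k * ?Z) \<le> ennreal (1 / d) * (ennreal d * ?A)"
    by (rule mult_left_mono) simp
  moreover have "ennreal (1 / d) * ennreal d = 1"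
    using d by (simp flip: ennreal_mult)
  moreover have "ennreal (1 / d) * ennreal k = ennreal (k / d)"
    using d k by (simp flip: ennreal_mult)
  ultimately have "ennreal (k / d) * ?Z \<le> ?A"
    by (simp flip: mult.assoc)
  then show ?thesis
    by (simp add: k_def d_def)
qed

section \<open>Finiteness and positivity of the integrals\<close>

lemma nn_integral_exp_abs_m_finite:
  assumes "a > 0"
  shows "(\<integral>\<^sup>+u. ennreal (exp (- a * \<bar>u\<bar>)) \<partial>m) < \<infinity>"
proof -
  have "(\<integral>\<^sup>+u. ennreal (exp (- a * \<bar>u\<bar>)) \<partial>m)
      \<le> (\<integral>\<^sup>+u. ennreal (exp (- a * \<bar>u\<bar>)) \<partial>lborel) + ennreal M * 1"
    using assms by (intro m_le) (auto simp: mult_nonneg_nonneg)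
  also have "\<dots> < \<infinity>"
    using nn_integral_exp_abs_finite[OF assms] by simp
  finally show ?thesis .
qed

text \<open>Coercivity gives decay at rate k in the sum of |spins|. Half of the rate absorbs the
  squared spin, through x^2 / 2 <= exp x at x = (k / 2) |spin|, hence the 8 / k^2; the other half
  leaves a product of integrable single-site factors.\<close>

lemma moment_finite:
  assumes \<Lambda>: "finite \<Lambda>" "(0, 0) \<in> \<Lambda>"
  shows "(\<integral>\<^sup>+\<phi>. moment_weight \<Lambda> \<phi> \<partial>(Pi\<^sub>M \<Lambda> (\<lambda>_. m))) < \<infinity>"
proof -
  interpret product_sigma_finite "\<lambda>_::site. m"
    by (simp add: product_sigma_finite_def sigma_finite_m)
  obtain k K where k: "k > 0" and K: "\<And>\<phi>. (\<forall>x. x \<notin> \<Lambda> \<longrightarrow> \<phi> x = 0) \<Longrightarrow>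
      hamiltonian p V \<beta> \<phi> \<ge> k * (\<Sum>x\<in>\<Lambda>. \<bar>\<phi> x\<bar>) - K"
    using hamiltonian_coercive[OF \<Lambda>(1)] by blast
  let ?e = "\<lambda>u. ennreal (exp (- (k / 2) * \<bar>u\<bar>))"
  have "moment_weight \<Lambda> \<phi> \<le> ennreal (8 / k\<^sup>2 * exp K) * (\<Prod>x\<in>\<Lambda>. ?e (\<phi> x))" for \<phi>
  proof -
    have "(k / 2 * \<bar>\<phi> (0, 0)\<bar>)\<^sup>2 / 2 \<le> exp (k / 2 * \<bar>\<phi> (0, 0)\<bar>)"
    proof -
      have "0 \<le> k / 2 * \<bar>\<phi> (0, 0)\<bar>"
        using k by simp
      then show ?thesis
        using exp_lower_Taylor_quadratic[of "k / 2 * \<bar>\<phi> (0, 0)\<bar>"] by linarith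
    qed
    moreover have "k / 2 * \<bar>\<phi> (0, 0)\<bar> \<le> k / 2 * (\<Sum>x\<in>\<Lambda>. \<bar>\<phi> x\<bar>)"
      using k member_le_sum[of "(0, 0)" \<Lambda> "\<lambda>x. \<bar>\<phi> x\<bar>"] \<Lambda> by (intro mult_left_mono) auto
    ultimately have "(k / 2 * \<bar>\<phi> (0, 0)\<bar>)\<^sup>2 / 2 \<le> exp (k / 2 * (\<Sum>x\<in>\<Lambda>. \<bar>\<phi> x\<bar>))"
      by (meson exp_le_cancel_iff order_trans)
    then have sq: "(\<phi> (0, 0))\<^sup>2 \<le> 8 / k\<^sup>2 * exp (k / 2 * (\<Sum>x\<in>\<Lambda>. \<bar>\<phi> x\<bar>))"
      using k by (simp add: power_mult_distrib power_divide field_simps)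
    have "hamiltonian p V \<beta> (extend_zero \<Lambda> \<phi>) \<ge> k * (\<Sum>x\<in>\<Lambda>. \<bar>extend_zero \<Lambda> \<phi> x\<bar>) - K"
      by (rule K) (simp add: extend_zero_def)
    also have "(\<Sum>x\<in>\<Lambda>. \<bar>extend_zero \<Lambda> \<phi> x\<bar>) = (\<Sum>x\<in>\<Lambda>. \<bar>\<phi> x\<bar>)"
      by (simp add: extend_zero_def)
    finally have bz: "exp (- hamiltonian p V \<beta> (extend_zero \<Lambda> \<phi>)) \<le> exp (K - k * (\<Sum>x\<in>\<Lambda>. \<bar>\<phi> x\<bar>))"
      by simp
    have "(\<phi> (0, 0))\<^sup>2 * exp (- hamiltonian p V \<beta> (extend_zero \<Lambda> \<phi>))
        \<le> 8 / k\<^sup>2 * exp (k / 2 * (\<Sum>x\<in>\<Lambda>. \<bar>\<phi> x\<bar>)) * exp (K - k * (\<Sum>x\<in>\<Lambda>. \<bar>\<phi> x\<bar>))"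
      using sq bz by (intro mult_mono) auto
    also have "\<dots> = 8 / k\<^sup>2 * exp K * exp (- (k / 2) * (\<Sum>x\<in>\<Lambda>. \<bar>\<phi> x\<bar>))"
      by (simp add: exp_add[symmetric] algebra_simps)
    also have "exp (- (k / 2) * (\<Sum>x\<in>\<Lambda>. \<bar>\<phi> x\<bar>)) = (\<Prod>x\<in>\<Lambda>. exp (- (k / 2) * \<bar>\<phi> x\<bar>))"
      using \<Lambda>(1) by (simp only: sum_distrib_left exp_sum)
    finally have "ennreal ((\<phi> (0, 0))\<^sup>2 * exp (- hamiltonian p V \<beta> (extend_zero \<Lambda> \<phi>)))
        \<le> ennreal (8 / k\<^sup>2 * exp K * (\<Prod>x\<in>\<Lambda>. exp (- (k / 2) * \<bar>\<phi> x\<bar>)))"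
      by (rule ennreal_leI)
    moreover have "moment_weight \<Lambda> \<phi> = ennreal ((\<phi> (0, 0))\<^sup>2 * exp (- hamiltonian p V \<beta> (extend_zero \<Lambda> \<phi>)))"
      using \<Lambda>(2) by (simp add: moment_weight_def boltzmann_def ennreal_mult) (simp add: extend_zero_def)
    moreover have "ennreal (8 / k\<^sup>2 * exp K * (\<Prod>x\<in>\<Lambda>. exp (- (k / 2) * \<bar>\<phi> x\<bar>)))
        = ennreal (8 / k\<^sup>2 * exp K) * (\<Prod>x\<in>\<Lambda>. ?e (\<phi> x))"
      by (subst ennreal_mult) (auto intro: prod_nonneg simp: prod_ennreal)
    ultimately show ?thesis
      by (simp only:)
  qed
  then have "(\<integral>\<^sup>+\<phi>. moment_weight \<Lambda> \<phi> \<partial>(Pi\<^sub>M \<Lambda> (\<lambda>_. m)))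
      \<le> (\<integral>\<^sup>+\<phi>. ennreal (8 / k\<^sup>2 * exp K) * (\<Prod>x\<in>\<Lambda>. ?e (\<phi> x)) \<partial>(Pi\<^sub>M \<Lambda> (\<lambda>_. m)))"
    by (intro nn_integral_mono)
  also have "\<dots> = ennreal (8 / k\<^sup>2 * exp K) * (\<integral>\<^sup>+\<phi>. (\<Prod>x\<in>\<Lambda>. ?e (\<phi> x)) \<partial>(Pi\<^sub>M \<Lambda> (\<lambda>_. m)))"
    by (intro nn_integral_cmult) measurable
  also have "(\<integral>\<^sup>+\<phi>. (\<Prod>x\<in>\<Lambda>. ?e (\<phi> x)) \<partial>(Pi\<^sub>M \<Lambda> (\<lambda>_. m))) = (\<Prod>x\<in>\<Lambda>. \<integral>\<^sup>+u. ?e u \<partial>m)"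
    using \<Lambda> by (intro product_nn_integral_prod) auto
  also have "ennreal (8 / k\<^sup>2 * exp K) * \<dots> < \<infinity>"
  proof -
    have "(\<integral>\<^sup>+u. ?e u \<partial>m) < \<infinity>"
      using k by (intro nn_integral_exp_abs_m_finite) auto
    then show ?thesis
      by (simp add: ennreal_mult_less_top power_less_top_ennreal)
  qed
  finally show ?thesis .
qed

lemma partition_pos:
  assumes "finite \<Lambda>"
  shows "(\<integral>\<^sup>+\<phi>. boltzmann \<Lambda> \<phi> \<partial>(Pi\<^sub>M \<Lambda> (\<lambda>_. m))) \<noteq> 0"
proof
  interpret product_sigma_finite "\<lambda>_::site. m"
    by (simp add: product_sigma_finite_def sigma_finite_m)
  let ?P = "Pi\<^sub>M \<Lambda> (\<lambda>_. m)"
  have "boltzmann \<Lambda> \<in> borel_measurable ?P"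
    using boltzmann_measurable measurable_unpin_cong[of _ \<Lambda> "{}"] by (simp add: unpin_def)
  moreover assume "(\<integral>\<^sup>+\<phi>. boltzmann \<Lambda> \<phi> \<partial>?P) = 0"
  ultimately have "AE \<phi> in ?P. boltzmann \<Lambda> \<phi> = 0"
    by (subst (asm) nn_integral_0_iff_AE) auto
  then have "AE \<phi> in ?P. False"
    by (rule AE_mp) (auto simp: boltzmann_def)
  then have "emeasure ?P (space ?P) = 0"
    by (simp add: AE_iff_null null_setsD1)
  moreover have "emeasure ?P (space ?P) = (\<Prod>x\<in>\<Lambda>. emeasure m UNIV)"
    using assms by (simp add: space_PiM emeasure_PiM)
  moreover have "emeasure m UNIV \<noteq> 0"
    using m_ge[of "\<lambda>_. 1"] by auto
  ultimately show False
    by simp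
qed

text \<open>The lower bound is read backwards: with B the origin alone and the indicator profile, of
  energy at most 2, a positive multiple of the partition function lies below the finite
  moment.\<close>

lemma partition_finite:
  assumes \<Lambda>: "finite \<Lambda>" "(0, 0) \<in> \<Lambda>"
  shows "(\<integral>\<^sup>+\<phi>. boltzmann \<Lambda> \<phi> \<partial>(\<Pi>\<^sub>M x\<in>\<Lambda>. m)) < \<infinity>"
proof -
  let ?Z = "\<integral>\<^sup>+\<phi>. boltzmann \<Lambda> \<phi> \<partial>(\<Pi>\<^sub>M x\<in>\<Lambda>. m)"
  define k where "k = 4 / (\<beta> * c * 2) / (exp (M * sqrt (\<beta> * c) * card {(0::int, 0::int)}) * (1 + exp 1))"
  have k: "k > 0"
    using beta_pos c_pos by (simp add: k_def add_pos_pos)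
  have "ennreal k * ?Z \<le> (\<integral>\<^sup>+\<phi>. moment_weight \<Lambda> \<phi> \<partial>(\<Pi>\<^sub>M x\<in>\<Lambda>. m))"
    unfolding k_def using \<Lambda> dirichlet_energy_single_site[of "(0, 0)"]
    by (intro moment_lower_bound[where B = "{(0, 0)}" and \<psi> = "\<lambda>y. of_bool (y = (0, 0))"]) auto
  also have "\<dots> < \<infinity>"
    using \<Lambda> by (rule moment_finite)
  finally show ?thesis
    using k by (auto simp: ennreal_mult_less_top)
qed

text \<open>The radius balances the two effects: a box of radius about 1 / sqrt e has at most 9 / e
  sites, so unpinning it costs at most exp 9, while its harmonic number is still at least |ln e| /
  2.\<close>

lemma log_moment_lower_bound:
  assumes S: "S \<ge> 0" "\<And>Z. finite Z \<Longrightarrow> (\<Sum>z\<in>Z. p z * (site_norm z)\<^sup>2) \<le> S"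
    and e: "e = M * sqrt (\<beta> * c)" "0 < e" "e \<le> 1"
    and \<Lambda>: "finite \<Lambda>" "site_box (nat \<lfloor>1 / sqrt e\<rfloor>) \<subseteq> \<Lambda>"
  shows "2 / ((18 * S + 1) * (exp 9 * (1 + exp 1))) / (c * \<beta>) * \<bar>ln e\<bar>
    \<le> enn2real ((\<integral>\<^sup>+\<phi>. moment_weight \<Lambda> \<phi> \<partial>(\<Pi>\<^sub>M x\<in>\<Lambda>. m)) / (\<integral>\<^sup>+\<phi>. boltzmann \<Lambda> \<phi> \<partial>(\<Pi>\<^sub>M x\<in>\<Lambda>. m)))"
    (is "_ \<le> enn2real (?A / ?Z)")
proof -
  define N where "N = nat \<lfloor>1 / sqrt e\<rfloor>"
  define h :: real where "h = harm N"
  have ge1: "1 / sqrt e \<ge> 1"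
    using e by simp
  have N: "N > 0" "real N \<le> 1 / sqrt e" "1 / sqrt e \<le> real N + 1"
    using ge1 unfolding N_def by linarith+
  have h: "h > 0"
    using harm_pos[OF N(1), where ?'a = real] by (simp add: h_def)
  have origin: "(0, 0) \<in> site_box N"
    by (simp add: site_box_def)
  \<comment> \<open>N is a floor, hence the comparison with N + 1, which matches the lower bound
    ln(N + 1) for harmonic numbers.\<close>
  have "\<bar>ln e\<bar> / 2 = ln (1 / sqrt e)"
    using e(2,3) by (simp add: ln_div ln_sqrt)
  also have "\<dots> \<le> ln (real N + 1)"
    using N ge1 e(2) by (subst ln_le_cancel_iff) auto
  also have "\<dots> \<le> h"
    unfolding h_def by (rule ln_le_harm)
  finally have ln_h: "\<bar>ln e\<bar> / 2 \<le> h" .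
  have "(real N)\<^sup>2 \<le> (1 / sqrt e)\<^sup>2"
    using N by (intro power_mono) auto
  then have "(real N)\<^sup>2 * e \<le> 1"
    using e(2) by (simp add: power_divide field_simps)
  \<comment> \<open>2 N + 1 <= 3 N because N >= 1, which in turn rests on e <= 1; this is where the
    9 arises.\<close>
  moreover have "(2 * real N + 1)\<^sup>2 \<le> (3 * real N)\<^sup>2"
    using N by (intro power_mono) auto
  then have "(2 * real N + 1)\<^sup>2 * e \<le> (3 * real N)\<^sup>2 * e"
    using e(2) by (intro mult_right_mono) auto
  then have "(2 * real N + 1)\<^sup>2 * e \<le> 9 * ((real N)\<^sup>2 * e)"
    by (simp add: power_mult_distrib)
  ultimately have card: "M * sqrt (\<beta> * c) * card (site_box N) \<le> 9"
    by (simp add: card_site_box mult.commute add.commute flip: e(1))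
  \<comment> \<open>The added 1 keeps the energy bound positive when S = 0, as the choice of the
    shift height divides by it.\<close>
  have "dirichlet_energy p (log_profile N) \<le> (18 * S + 1) / h"
  proof (rule dirichlet_energy_le[OF p_nonneg])
    show "(\<lambda>(x, y). p (x - y) * (log_profile N x - log_profile N y)\<^sup>2) summable_on UNIV"
      using log_profile_eq_0[OF N(1)]
      by (intro pair_sum_summable[OF finite_site_box[of N], where g = "\<lambda>s. s\<^sup>2"]) auto
  next
    fix z :: site and X :: "site set"
    assume "finite X"
    then show "(\<Sum>x\<in>X. (log_profile N (x + z) - log_profile N x)\<^sup>2) \<le> 18 * (site_norm z)\<^sup>2 / h"
      unfolding h_def by (rule log_profile_translate_le[OF N(1)])
  next
    fix Z :: "site set"
    assume "finite Z"
    have "(\<Sum>z\<in>Z. p z * (18 * (site_norm z)\<^sup>2 / h)) = 18 / h * (\<Sum>z\<in>Z. p z * (site_norm z)\<^sup>2)"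
      by (simp add: sum_distrib_left mult_ac)
    also have "\<dots> \<le> 18 / h * S"
      using S \<open>finite Z\<close> h by (intro mult_left_mono) auto
    also have "\<dots> \<le> (18 * S + 1) / h"
      using h by (simp add: divide_right_mono)
    finally show "(\<Sum>z\<in>Z. p z * (18 * (site_norm z)\<^sup>2 / h)) \<le> (18 * S + 1) / h" .
  qed
  moreover have "(18 * S + 1) / h > 0"
    using S h by simp
  ultimately have bound: "ennreal (4 / (\<beta> * c * ((18 * S + 1) / h)) / (exp 9 * (1 + exp 1))) * ?Z \<le> ?A"
    using \<Lambda> origin N log_profile_eq_0 log_profile_origin card unfolding N_def[symmetric]
    by (intro moment_lower_bound[where B = "site_box N" and \<psi> = "log_profile N"]) auto
  define k where "k = 4 / (\<beta> * c * ((18 * S + 1) / h)) / (exp 9 * (1 + exp 1))"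
  define d where "d = (18 * S + 1) * (exp 9 * (1 + exp 1)) * (c * \<beta>)"
  have d: "d > 0"
    unfolding d_def using S(1) beta_pos c_pos
    by (intro mult_pos_pos add_nonneg_pos[of "18 * S"] add_nonneg_pos[of 1]) auto
  have "2 / ((18 * S + 1) * (exp 9 * (1 + exp 1))) / (c * \<beta>) * \<bar>ln e\<bar> = 4 * (\<bar>ln e\<bar> / 2) / d"
    by (simp add: d_def)
  also have "\<dots> \<le> 4 * h / d"
    using ln_h d by (intro divide_right_mono mult_left_mono) auto
  also have "\<dots> = k"
    by (simp add: k_def d_def mult_ac)
  finally have "2 / ((18 * S + 1) * (exp 9 * (1 + exp 1))) / (c * \<beta>) * \<bar>ln e\<bar> \<le> k" .
  moreover have "k \<le> enn2real (?A / ?Z)"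
  proof -
    have O: "(0, 0) \<in> \<Lambda>"
      using \<Lambda> origin by (auto simp: N_def)
    \<comment> \<open>All three facts matter: the quotient must cancel the partition function, and
      an infinite moment would be sent to 0 by \<open>enn2real\<close>.\<close>
    have Z: "?Z \<noteq> 0" "?Z < \<infinity>" "?A < \<infinity>"
      using partition_pos[OF \<Lambda>(1)] partition_finite[OF \<Lambda>(1) O] moment_finite[OF \<Lambda>(1) O] by auto
    have "ennreal k * ?Z / ?Z \<le> ?A / ?Z"
      using bound unfolding k_def by (rule divide_right_mono_ennreal)
    then have "ennreal k \<le> ?A / ?Z"
      using Z by (simp add: ennreal_mult_divide_eq)
    moreover have "?A / ?Z < top"
      using Z by (simp add: ennreal_divide_eq_top_iff less_top[symmetric])
    ultimately show ?thesis
      using enn2real_mono[of "ennreal k" "?A / ?Z"] by (cases "0 \<le> k") (auto intro: order_trans[OF _ enn2real_nonneg])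
  qed
  ultimately show ?thesis
    by linarith
qed

text \<open>For a nonnegative measurable integrand the Bochner integral is \<open>enn2real\<close>
  of the nonnegative one, with the value 0 on both sides if it is infinite, so no integrability has
  to be known here.\<close>

lemma normalized_density_moment:
  "(\<integral>\<phi>. (\<phi> (0, 0))\<^sup>2 \<partial>normalized_density (reference_measure m \<Lambda>) (\<lambda>\<phi>. exp (- hamiltonian p V \<beta> \<phi>)))
    = enn2real ((\<integral>\<^sup>+\<phi>. moment_weight \<Lambda> \<phi> \<partial>(\<Pi>\<^sub>M x\<in>\<Lambda>. m)) / (\<integral>\<^sup>+\<phi>. boltzmann \<Lambda> \<phi> \<partial>(\<Pi>\<^sub>M x\<in>\<Lambda>. m)))"
proof -
  let ?R = "reference_measure m \<Lambda>"
  let ?F = "\<lambda>\<phi>. exp (- hamiltonian p V \<beta> \<phi>)"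
  have "(\<integral>\<phi>. (\<phi> (0, 0))\<^sup>2 \<partial>normalized_density ?R ?F)
      = enn2real (\<integral>\<^sup>+\<phi>. ennreal ((\<phi> (0, 0))\<^sup>2) \<partial>normalized_density ?R ?F)"
    by (rule integral_eq_nn_integral) auto
  also have "\<dots> = enn2real ((\<integral>\<^sup>+\<phi>. ennreal (?F \<phi>) * ennreal ((\<phi> (0, 0))\<^sup>2) \<partial>?R) / (\<integral>\<^sup>+\<phi>. ennreal (?F \<phi>) \<partial>?R))"
    by (subst nn_integral_normalized_density) auto
  finally show ?thesis
    by (simp add: nn_integral_reference_measure boltzmann_def moment_weight_def mult.commute)
qed

end

subsection \<open>Square-well and delta pinning\<close>

text \<open>Since c x - V' x is nondecreasing, V' grows by at most 2 c u over [s - u, s + u]. Hence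
  u |-> c u^2 - V (s + u) - V (s - u) is nondecreasing for u >= 0, and its values at 0 and h are
  compared. Negative h follow by symmetry.\<close>

lemma second_difference_le:
  fixes V :: "real \<Rightarrow> real"
  assumes V: "\<And>x. V differentiable (at x)" "\<And>x. deriv V differentiable (at x)"
    and c: "\<And>x. deriv (deriv V) x \<le> c"
  shows "V (s + h) + V (s - h) \<le> 2 * V s + c * h\<^sup>2"
proof -
  have V': "(V has_real_derivative deriv V x) (at x)" for x
    using V(1) DERIV_deriv_iff_real_differentiable by blast
  have V'': "(deriv V has_real_derivative deriv (deriv V) x) (at x)" for x
    using V(2) DERIV_deriv_iff_real_differentiable by blast
  have lip: "deriv V y - deriv V x \<le> c * (y - x)" if "x \<le> y" for x y
  proof -
    have "c * x - deriv V x \<le> c * y - deriv V y"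
      using that
    proof (rule DERIV_nonneg_imp_nondecreasing)
      fix u
      have "((\<lambda>u. c * u - deriv V u) has_real_derivative c - deriv (deriv V) u) (at u)"
        by (auto intro!: derivative_eq_intros V'')
      then show "\<exists>d. ((\<lambda>u. c * u - deriv V u) has_real_derivative d) (at u) \<and> 0 \<le> d"
        using c[of u] by (intro exI[of _ "c - deriv (deriv V) u"]) auto
    qed
    then show ?thesis
      by (simp add: algebra_simps)
  qed
  have nonneg: "V (s + h) + V (s - h) \<le> 2 * V s + c * h\<^sup>2" if "0 \<le> h" for h
  proof -
    have "c * 0\<^sup>2 - V (s + 0) - V (s - 0) \<le> c * h\<^sup>2 - V (s + h) - V (s - h)"
      using that
    proof (rule DERIV_nonneg_imp_nondecreasing)
      fix u :: real
      assume "0 \<le> u" "u \<le> h"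
      have "((\<lambda>u. s + u) has_real_derivative 1) (at u)" "((\<lambda>u. s - u) has_real_derivative - 1) (at u)"
        by (auto intro!: derivative_eq_intros)
      from DERIV_chain2[OF V' this(1)] DERIV_chain2[OF V' this(2)] have "((\<lambda>u. c * u\<^sup>2 - V (s + u) - V (s - u)) has_real_derivative
          2 * c * u - deriv V (s + u) + deriv V (s - u)) (at u)"
        by (auto intro!: derivative_eq_intros)
      moreover have "0 \<le> 2 * c * u - deriv V (s + u) + deriv V (s - u)"
        using lip[of "s - u" "s + u"] \<open>0 \<le> u\<close> by (simp add: algebra_simps)
      ultimately show "\<exists>d. ((\<lambda>u. c * u\<^sup>2 - V (s + u) - V (s - u)) has_real_derivative d) (at u) \<and> 0 \<le> d"
        by blast
    qed
    then show ?thesis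
      by simp
  qed
  show ?thesis
    using nonneg[of h] nonneg[of "- h"] by (cases "0 \<le> h") auto
qed

text \<open>|x|^2 <= 1 + |x|^(2 + \<delta>), and p is summable. The number S, a bound on finite
  sums, is the quantity through which the final constant depends on p.\<close>

lemma admissible_kernel_second_moment:
  assumes "admissible_kernel p"
  obtains S where "S \<ge> 0" "\<And>Z. finite Z \<Longrightarrow> (\<Sum>z\<in>Z. p z * (site_norm z)\<^sup>2) \<le> S"
proof -
  have p: "0 \<le> p x" for x
    using assms unfolding admissible_kernel_def by blast
  have sp: "p summable_on UNIV"
    using assms by (auto simp: admissible_kernel_def summable_on_def)
  obtain \<delta> where \<delta>: "\<delta> > 0" "(\<lambda>x. p x * site_norm x powr (2 + \<delta>)) summable_on UNIV"
    using assms by (auto simp: admissible_kernel_def)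
  have norm: "(site_norm x)\<^sup>2 \<le> 1 + site_norm x powr (2 + \<delta>)" for x
  proof (cases "site_norm x \<le> 1")
    case True
    then have "(site_norm x)\<^sup>2 \<le> 1"
      by (simp add: site_norm_def power_le_one)
    then show ?thesis
      by (simp add: add_increasing2)
  next
    case False
    then have "site_norm x powr 2 \<le> site_norm x powr (2 + \<delta>)"
      using \<delta> by (intro powr_mono) auto
    then show ?thesis
      using False by simp
  qed
  have sum: "(\<lambda>x. p x * (site_norm x)\<^sup>2) summable_on UNIV"
  proof (rule summable_on_comparison_test)
    show "(\<lambda>x. p x + p x * site_norm x powr (2 + \<delta>)) summable_on UNIV"
      using sp \<delta>(2) by (rule summable_on_add)
    show "p x * (site_norm x)\<^sup>2 \<le> p x + p x * site_norm x powr (2 + \<delta>)" for x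
      using mult_left_mono[OF norm p, of x x] by (simp add: distrib_left)
  qed (simp add: p)
  show thesis
  proof (rule that)
    show "(\<Sum>\<^sub>\<infinity>x. p x * (site_norm x)\<^sup>2) \<ge> 0"
      by (rule infsum_nonneg) (simp add: p)
    show "(\<Sum>z\<in>Z. p z * (site_norm z)\<^sup>2) \<le> (\<Sum>\<^sub>\<infinity>x. p x * (site_norm x)\<^sup>2)" if "finite Z" for Z
      using that sum p by (intro finite_sum_le_infsum) auto
  qed
qed

section \<open>Single-site laws of the two kinds of pinning\<close>

lemma nn_integral_pinned_lborel:
  assumes "f \<in> borel_measurable borel"
  shows "(\<integral>\<^sup>+u. f u \<partial>pinned_lborel \<epsilon>) = (\<integral>\<^sup>+u. f u \<partial>lborel) + ennreal \<epsilon> * f 0"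
  using assms
proof (induction rule: borel_measurable_induct)
  case (cong f g)
  then have "f = g" by auto
  then show ?case
    using cong by simp
next
  case (set A)
  then show ?case
    by (simp add: emeasure_pinned_lborel)
next
  case (mult f a)
  then show ?case
    by (simp add: nn_integral_cmult distrib_left mult_ac)
next
  case (add f g)
  then show ?case
    by (simp add: nn_integral_add distrib_left add_ac)
next
  case (seq F)
  have point: "(SUP i. F i) 0 = (SUP i. F i 0)"
    by (simp add: SUP_apply image_image)
  have mono: "incseq (\<lambda>i. \<integral>\<^sup>+u. F i u \<partial>lborel)" "incseq (\<lambda>i. ennreal \<epsilon> * F i 0)"
    using seq by (auto simp: incseq_def le_fun_def intro!: nn_integral_mono mult_left_mono)
  have "(\<integral>\<^sup>+u. (SUP i. F i) u \<partial>pinned_lborel \<epsilon>) = (SUP i. \<integral>\<^sup>+u. F i u \<partial>pinned_lborel \<epsilon>)"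
    using seq by (simp add: SUP_apply image_image nn_integral_monotone_convergence_SUP)
  also have "\<dots> = (SUP i. (\<integral>\<^sup>+u. F i u \<partial>lborel) + ennreal \<epsilon> * F i 0)"
    using seq by simp
  also have "\<dots> = (SUP i. \<integral>\<^sup>+u. F i u \<partial>lborel) + (SUP i. ennreal \<epsilon> * F i 0)"
    using mono by (rule ennreal_SUP_add)
  also have "(SUP i. \<integral>\<^sup>+u. F i u \<partial>lborel) = (\<integral>\<^sup>+u. (SUP i. F i) u \<partial>lborel)"
    using seq by (simp add: SUP_apply image_image nn_integral_monotone_convergence_SUP)
  also have "(SUP i. ennreal \<epsilon> * F i 0) = ennreal \<epsilon> * (SUP i. F i) 0"
    unfolding point by (rule SUP_mult_left_ennreal[symmetric])
  finally show ?case .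
qed

text \<open>The reward for the number of spins in the well factorises over sites; this is the share
  of one site. Its density is 1 + (exp b - 1) times the indicator of [- a, a].\<close>

definition well_measure :: "real \<Rightarrow> real \<Rightarrow> real measure" where
  "well_measure a b = density lborel (\<lambda>u. ennreal (exp (b * indicator {- a..a} u)))"

context gradient_model
begin

text \<open>The case M = 0 shows that the normaliser of the free measure is positive and
  finite.\<close>

lemma pinned_model_lborel: "pinned_model p V \<beta> c lborel 0"
  by unfold_locales auto

lemma pinned_model_pinned_lborel:
  assumes "\<epsilon> \<ge> 0"
  shows "pinned_model p V \<beta> c (pinned_lborel \<epsilon>) \<epsilon>"
  using assms
  by unfold_locales (auto simp: nn_integral_pinned_lborel intro!: add_left_mono mult_left_mono)

lemma pinned_model_well_measure:
  assumes "a \<ge> 0" "b \<ge> 0"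
  shows "pinned_model p V \<beta> c (well_measure a b) (2 * a * (exp b - 1))"
proof
  have w: "ennreal (exp (b * indicator {- a..a} u)) = 1 + ennreal (exp b - 1) * indicator {- a..a} u" for u
    using assms ennreal_plus[of 1 "exp b - 1"] by (auto simp: indicator_def)
  have int: "(\<integral>\<^sup>+u. f u \<partial>well_measure a b)
      = (\<integral>\<^sup>+u. f u \<partial>lborel) + ennreal (exp b - 1) * (\<integral>\<^sup>+u. f u * indicator {- a..a} u \<partial>lborel)"
    if [measurable]: "f \<in> borel_measurable borel" for f
  proof -
    have "(\<integral>\<^sup>+u. f u \<partial>well_measure a b)
        = (\<integral>\<^sup>+u. f u + ennreal (exp b - 1) * (f u * indicator {- a..a} u) \<partial>lborel)"
      unfolding well_measure_def w by (subst nn_integral_density) (auto simp: distrib_left mult_ac)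
    then show ?thesis
      by (simp add: nn_integral_add nn_integral_cmult)
  qed
  fix f :: "real \<Rightarrow> ennreal"
  assume f: "f \<in> borel_measurable borel"
  show "(\<integral>\<^sup>+u. f u \<partial>lborel) \<le> (\<integral>\<^sup>+u. f u \<partial>well_measure a b)"
    by (simp add: int f)
  fix K
  assume K: "\<And>u. f u \<le> K"
  have "(\<integral>\<^sup>+u. f u * indicator {- a..a} u \<partial>lborel) \<le> (\<integral>\<^sup>+u. K * indicator {- a..a} u \<partial>lborel)"
    using K by (intro nn_integral_mono mult_right_mono) auto
  also have "\<dots> = K * ennreal (2 * a)"
    using assms by (simp add: nn_integral_cmult)
  finally have "ennreal (exp b - 1) * (\<integral>\<^sup>+u. f u * indicator {- a..a} u \<partial>lborel)
      \<le> ennreal (exp b - 1) * (K * ennreal (2 * a))"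
    by (rule mult_left_mono) simp
  also have "\<dots> = ennreal (2 * a * (exp b - 1)) * K"
    using assms by (subst ennreal_mult) (auto simp: mult_ac)
  finally show "(\<integral>\<^sup>+u. f u \<partial>well_measure a b)
      \<le> (\<integral>\<^sup>+u. f u \<partial>lborel) + ennreal (2 * a * (exp b - 1)) * K"
    by (simp add: int f add_left_mono)
qed (use assms in \<open>auto simp: well_measure_def\<close>)

lemma delta_pinned_moment:
  assumes S: "S \<ge> 0" "\<And>Z. finite Z \<Longrightarrow> (\<Sum>z\<in>Z. p z * (site_norm z)\<^sup>2) \<le> S"
    and e: "e = \<epsilon> * sqrt (\<beta> * c)" "0 < e" "e \<le> 1" and \<epsilon>: "\<epsilon> \<ge> 0"
    and \<Lambda>: "finite \<Lambda>" "site_box (nat \<lfloor>1 / sqrt e\<rfloor>) \<subseteq> \<Lambda>"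
  shows "2 / ((18 * S + 1) * (exp 9 * (1 + exp 1))) / (c * \<beta>) * \<bar>ln e\<bar>
    \<le> (\<integral>\<phi>. (\<phi> (0, 0))\<^sup>2 \<partial>(delta_pinned_measure p V \<beta> \<epsilon> \<Lambda>))"
proof -
  interpret pinned_model p V \<beta> c "pinned_lborel \<epsilon>" \<epsilon>
    using \<epsilon> by (rule pinned_model_pinned_lborel)
  show ?thesis
    unfolding delta_pinned_measure_def normalized_density_moment
    by (rule log_moment_lower_bound[OF S e \<Lambda>])
qed

text \<open>The square-well measure is normalised twice, once as a free measure and once for the
  reward. The free normaliser cancels, and the reward moves into the product measure, which reduces
  the claim to \<open>log_moment_lower_bound\<close>.\<close>

lemma square_well_moment:
  assumes S: "S \<ge> 0" "\<And>Z. finite Z \<Longrightarrow> (\<Sum>z\<in>Z. p z * (site_norm z)\<^sup>2) \<le> S"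
    and e: "e = 2 * a * (exp b - 1) * sqrt (\<beta> * c)" "0 < e" "e \<le> 1" and ab: "a \<ge> 0" "b \<ge> 0"
    and \<Lambda>: "finite \<Lambda>" "site_box (nat \<lfloor>1 / sqrt e\<rfloor>) \<subseteq> \<Lambda>"
  shows "2 / ((18 * S + 1) * (exp 9 * (1 + exp 1))) / (c * \<beta>) * \<bar>ln e\<bar>
    \<le> (\<integral>\<phi>. (\<phi> (0, 0))\<^sup>2 \<partial>(square_well_measure p V \<beta> a b \<Lambda>))"
proof -
  interpret well: pinned_model p V \<beta> c "well_measure a b" "2 * a * (exp b - 1)"
    using ab by (rule pinned_model_well_measure)
  interpret free: pinned_model p V \<beta> c lborel 0
    by (rule pinned_model_lborel)
  let ?R = "reference_measure lborel \<Lambda>" and ?P = "\<Pi>\<^sub>M x\<in>\<Lambda>. lborel :: real measure"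
  let ?F = "\<lambda>\<phi>. exp (- hamiltonian p V \<beta> \<phi>)"
  let ?G = "\<lambda>\<phi>. exp (b * (\<Sum>x\<in>\<Lambda>. of_bool (\<bar>\<phi> x\<bar> \<le> a)))"
  let ?w = "\<lambda>u. ennreal (exp (b * indicator {- a..a} u))"
  define Z0 where "Z0 = (\<integral>\<^sup>+\<phi>. ennreal (?F \<phi>) \<partial>?R)"
  have Z0_eq: "Z0 = (\<integral>\<^sup>+\<phi>. free.boltzmann \<Lambda> \<phi> \<partial>?P)"
    by (simp add: Z0_def nn_integral_reference_measure free.boltzmann_def)
  have origin: "(0, 0) \<in> \<Lambda>"
    using \<Lambda> by (auto simp: site_box_def)
  have Z0: "Z0 \<noteq> 0" "Z0 < \<infinity>"
    unfolding Z0_eq using free.partition_pos[OF \<Lambda>(1)] free.partition_finite[OF \<Lambda>(1) origin] by auto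
  have of_bool_eq: "of_bool (\<bar>u\<bar> \<le> a) = (indicator {- a..a} u :: real)" for u
    by (auto simp: indicator_def abs_le_iff)
  have G [measurable]: "?G \<in> borel_measurable (\<Pi>\<^sub>M x\<in>UNIV. borel)"
    unfolding of_bool_eq by measurable
  have PiM: "(\<Pi>\<^sub>M x\<in>\<Lambda>. well_measure a b) = density ?P (\<lambda>\<phi>. \<Prod>x\<in>\<Lambda>. ?w (\<phi> x))"
    using well.sigma_finite_m unfolding well_measure_def
    by (intro density_PiM \<Lambda> sigma_finite_lborel) auto
  \<comment> \<open>Used for g the squared spin at the origin (numerator) and g = 1
    (denominator).\<close>
  have free: "(\<integral>\<^sup>+\<phi>. ennreal (?G \<phi>) * g \<phi> \<partial>free_measure p V \<beta> \<Lambda>)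
      = (\<integral>\<^sup>+\<phi>. g (extend_zero \<Lambda> \<phi>) * well.boltzmann \<Lambda> \<phi> \<partial>(\<Pi>\<^sub>M x\<in>\<Lambda>. well_measure a b)) * inverse Z0"
    if g [measurable]: "g \<in> borel_measurable (\<Pi>\<^sub>M x\<in>UNIV. borel)" for g
  proof -
    have "(\<integral>\<^sup>+\<phi>. ennreal (?G \<phi>) * g \<phi> \<partial>free_measure p V \<beta> \<Lambda>)
        = (\<integral>\<^sup>+\<phi>. ennreal (?F \<phi>) * (ennreal (?G \<phi>) * g \<phi>) \<partial>?R) * inverse Z0"
      unfolding free_measure_def Z0_def by (subst nn_integral_normalized_density) (auto simp: divide_ennreal_def)
    also have "(\<integral>\<^sup>+\<phi>. ennreal (?F \<phi>) * (ennreal (?G \<phi>) * g \<phi>) \<partial>?R)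
        = (\<integral>\<^sup>+\<phi>. ennreal (?F (extend_zero \<Lambda> \<phi>)) * (ennreal (?G (extend_zero \<Lambda> \<phi>)) * g (extend_zero \<Lambda> \<phi>)) \<partial>?P)"
      by (rule nn_integral_reference_measure) auto
    also have "\<dots> = (\<integral>\<^sup>+\<phi>. (\<Prod>x\<in>\<Lambda>. ?w (\<phi> x)) * (g (extend_zero \<Lambda> \<phi>) * well.boltzmann \<Lambda> \<phi>) \<partial>?P)"
    proof (rule nn_integral_cong)
      fix \<phi> :: field_config
      have "?G (extend_zero \<Lambda> \<phi>) = exp (\<Sum>x\<in>\<Lambda>. b * indicator {- a..a} (\<phi> x))"
        unfolding of_bool_eq sum_distrib_left by (simp add: extend_zero_def)
      then have "ennreal (?G (extend_zero \<Lambda> \<phi>)) = (\<Prod>x\<in>\<Lambda>. ?w (\<phi> x))"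
        by (simp only: exp_sum[OF \<Lambda>(1)] prod_ennreal exp_ge_zero)
      then show "ennreal (?F (extend_zero \<Lambda> \<phi>)) * (ennreal (?G (extend_zero \<Lambda> \<phi>)) * g (extend_zero \<Lambda> \<phi>))
          = (\<Prod>x\<in>\<Lambda>. ?w (\<phi> x)) * (g (extend_zero \<Lambda> \<phi>) * well.boltzmann \<Lambda> \<phi>)"
        by (simp add: well.boltzmann_def mult_ac)
    qed
    also have "\<dots> = (\<integral>\<^sup>+\<phi>. g (extend_zero \<Lambda> \<phi>) * well.boltzmann \<Lambda> \<phi> \<partial>(\<Pi>\<^sub>M x\<in>\<Lambda>. well_measure a b))"
      unfolding PiM
    proof (rule nn_integral_density[symmetric])
      have sets: "borel_measurable ?P = borel_measurable (\<Pi>\<^sub>M x\<in>\<Lambda>. borel :: real measure)"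
        by (intro measurable_cong_sets sets_PiM_cong) auto
      show "(\<lambda>\<phi>. \<Prod>x\<in>\<Lambda>. ?w (\<phi> x)) \<in> borel_measurable ?P"
        by (intro borel_measurable_prod_ennreal) measurable
      have "(\<lambda>\<phi>. g (extend_zero \<Lambda> \<phi>)) \<in> borel_measurable ?P"
        by (intro measurable_compose[OF extend_zero_measurable g]) auto
      moreover have "well.boltzmann \<Lambda> \<in> borel_measurable ?P"
        unfolding sets by (rule well.boltzmann_measurable)
      ultimately show "(\<lambda>\<phi>. g (extend_zero \<Lambda> \<phi>) * well.boltzmann \<Lambda> \<phi>) \<in> borel_measurable ?P"
        by measurable
    qed
    finally show ?thesis .
  qed
  let ?A = "\<integral>\<^sup>+\<phi>. well.moment_weight \<Lambda> \<phi> \<partial>(\<Pi>\<^sub>M x\<in>\<Lambda>. well_measure a b)"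
  let ?Z = "\<integral>\<^sup>+\<phi>. well.boltzmann \<Lambda> \<phi> \<partial>(\<Pi>\<^sub>M x\<in>\<Lambda>. well_measure a b)"
  have sets_free: "sets (free_measure p V \<beta> \<Lambda>) = sets (\<Pi>\<^sub>M x\<in>UNIV. borel)"
    by (simp add: free_measure_def)
  have meas: "borel_measurable (free_measure p V \<beta> \<Lambda>)
      = (borel_measurable (\<Pi>\<^sub>M x\<in>UNIV. borel) :: (field_config \<Rightarrow> 'r::topological_space) set)"
    by (intro measurable_cong_sets sets_free refl)
  have "(\<integral>\<phi>. (\<phi> (0, 0))\<^sup>2 \<partial>(square_well_measure p V \<beta> a b \<Lambda>))
      = enn2real (\<integral>\<^sup>+\<phi>. ennreal ((\<phi> (0, 0))\<^sup>2) \<partial>(square_well_measure p V \<beta> a b \<Lambda>))"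
  proof (rule integral_eq_nn_integral)
    have "borel_measurable (square_well_measure p V \<beta> a b \<Lambda>)
        = (borel_measurable (\<Pi>\<^sub>M x\<in>UNIV. borel) :: (field_config \<Rightarrow> real) set)"
      by (intro measurable_cong_sets) (auto simp: square_well_measure_def sets_free)
    then show "(\<lambda>\<phi>. (\<phi> (0, 0))\<^sup>2) \<in> borel_measurable (square_well_measure p V \<beta> a b \<Lambda>)"
      by simp
  qed simp
  also have "(\<integral>\<^sup>+\<phi>. ennreal ((\<phi> (0, 0))\<^sup>2) \<partial>(square_well_measure p V \<beta> a b \<Lambda>))
      = (?A * inverse Z0) / (?Z * inverse Z0)"
  proof -
    have "(\<integral>\<^sup>+\<phi>. ennreal ((\<phi> (0, 0))\<^sup>2) \<partial>(square_well_measure p V \<beta> a b \<Lambda>))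
        = (\<integral>\<^sup>+\<phi>. ennreal (?G \<phi>) * ennreal ((\<phi> (0, 0))\<^sup>2) \<partial>free_measure p V \<beta> \<Lambda>)
          / (\<integral>\<^sup>+\<phi>. ennreal (?G \<phi>) \<partial>free_measure p V \<beta> \<Lambda>)"
      unfolding square_well_measure_def
      by (rule nn_integral_normalized_density) (simp_all add: meas)
    then show ?thesis
      using free[of "\<lambda>\<phi>. ennreal ((\<phi> (0, 0))\<^sup>2)"] free[of "\<lambda>_. 1"]
      by (simp add: well.moment_weight_def)
  qed
  \<comment> \<open>Cancelling Z0 in \<open>ennreal\<close> is legitimate because it is neither 0
    nor infinite.\<close>
  also have "\<dots> = ?A / ?Z"
  proof -
    have "?Z < \<infinity>"
      by (rule well.partition_finite[OF \<Lambda>(1) origin])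
    moreover obtain z where "Z0 = ennreal z" "z > 0"
      using Z0 by (cases Z0) (auto simp: less_le)
    then have inv: "inverse Z0 * Z0 = 1" "inverse (inverse Z0) = Z0"
      by (simp_all add: inverse_ennreal flip: ennreal_mult)
    ultimately have "inverse (?Z * inverse Z0) = inverse ?Z * Z0"
      using Z0 by (subst ennreal_inverse_mult) (auto simp: less_top[symmetric])
    moreover have "?A * inverse Z0 * (inverse ?Z * Z0) = ?A * inverse ?Z * (inverse Z0 * Z0)"
      by (simp only: mult_ac)
    ultimately show ?thesis
      unfolding divide_ennreal_def by (simp only: inv(1) mult_1_right)
  qed
  finally show ?thesis
    using well.log_moment_lower_bound[OF S e \<Lambda>] by simp
qed

end

lemma liminf_volume_ge:
  assumes "finite B" "\<And>\<Lambda>. finite \<Lambda> \<Longrightarrow> B \<subseteq> \<Lambda> \<Longrightarrow> K \<le> f \<Lambda>"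
  shows "ereal K \<le> liminf_volume f"
  unfolding liminf_volume_def
  by (rule Liminf_bounded) (use assms in \<open>auto simp: eventually_finite_subsets_at_top\<close>)

theorem theorem2p1:
  fixes p :: "int \<times> int \<Rightarrow> real"
  assumes "admissible_kernel p"
  shows "\<exists>C::real. C > 0 \<and>
    (\<forall>(V :: real \<Rightarrow> real) (c :: real).
       c > 0 \<longrightarrow>
       (\<forall>x. V (- x) = V x) \<longrightarrow>
       convex_on UNIV V \<longrightarrow>
       \<not> (\<exists>k. \<forall>x. V x = k) \<longrightarrow>
       C2_function V \<longrightarrow>
       (\<forall>x. 0 \<le> deriv (deriv V) x \<and> deriv (deriv V) x \<le> c) \<longrightarrow>
       (\<exists>e0::real. 0 < e0 \<and> e0 < 1 \<and>
          (\<forall>a b \<beta> e :: real.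
             a > 0 \<longrightarrow> b > 0 \<longrightarrow> \<beta> > 0 \<longrightarrow>
             e = 2 * a * sqrt (\<beta> * c) * (exp b - 1) \<longrightarrow>
             e \<le> e0 \<longrightarrow>
             2 * a * sqrt (\<beta> * c) \<le> sqrt \<bar>ln e\<bar> \<longrightarrow>
             liminf_volume
               (\<lambda>\<Lambda>. \<integral>\<phi>. (\<phi> (0, 0))\<^sup>2 \<partial>(square_well_measure p V \<beta> a b \<Lambda>))
               \<ge> ereal (C / (c * \<beta>) * \<bar>ln e\<bar>)) \<and>
          (\<forall>\<epsilon> \<beta> e :: real.
             \<epsilon> > 0 \<longrightarrow> \<beta> > 0 \<longrightarrow>
             e = \<epsilon> * sqrt (\<beta> * c) \<longrightarrow>
             e \<le> e0 \<longrightarrow>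
             liminf_volume
               (\<lambda>\<Lambda>. \<integral>\<phi>. (\<phi> (0, 0))\<^sup>2 \<partial>(delta_pinned_measure p V \<beta> \<epsilon> \<Lambda>))
               \<ge> ereal (C / (c * \<beta>) * \<bar>ln e\<bar>))))"
proof -
  obtain S where S: "S \<ge> 0" "\<And>Z. finite Z \<Longrightarrow> (\<Sum>z\<in>Z. p z * (site_norm z)\<^sup>2) \<le> S"
    using admissible_kernel_second_moment[OF assms] by blast
  \<comment> \<open>C depends on p alone, through S, and is fixed before V and c. Its numerator 2 is
    the 4 from t^2 = 4 / (beta c K) times the 1/2 from \<open>harm N\<close> >= |ln e| / 2.\<close>
  define C where "C = 2 / ((18 * S + 1) * (exp 9 * (1 + exp (1::real))))"
  have C: "C > 0"
    unfolding C_def using S(1)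
    by (intro divide_pos_pos mult_pos_pos add_nonneg_pos[of "18 * S"] add_nonneg_pos[of 1]) auto
  have model: "gradient_model p V \<beta> c"
    if "c > 0" "\<forall>x. V (- x) = V x" "convex_on UNIV V" "\<not> (\<exists>k. \<forall>x. V x = k)" "C2_function V"
      "\<forall>x. 0 \<le> deriv (deriv V) x \<and> deriv (deriv V) x \<le> c" "\<beta> > 0" for V :: "real \<Rightarrow> real" and c \<beta>
  proof
    show "V (s + h) + V (s - h) \<le> 2 * V s + c * h\<^sup>2" for s h
      using that by (intro second_difference_le) (auto simp: C2_function_def)
    show "\<exists>s. V s \<noteq> V 0"
      using that by metis
  qed (use that assms in \<open>unfold admissible_kernel_def, blast+\<close>)
  \<comment> \<open>The estimates hold for 0 < e <= 1, so any number strictly between 0 and 1 can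
    serve as the threshold; 1 / 2 is chosen.\<close>
  show ?thesis
  proof (rule exI[of _ C], intro conjI C allI impI exI[of _ "1 / 2 :: real"])
    fix V :: "real \<Rightarrow> real" and c a b \<beta> e :: real
    assume V: "c > 0" "\<forall>x. V (- x) = V x" "convex_on UNIV V" "\<not> (\<exists>k. \<forall>x. V x = k)" "C2_function V"
      "\<forall>x. 0 \<le> deriv (deriv V) x \<and> deriv (deriv V) x \<le> c"
      and ab: "a > 0" "b > 0" "\<beta> > 0"
      and e: "e = 2 * a * sqrt (\<beta> * c) * (exp b - 1)" "e \<le> 1 / 2"
    interpret gradient_model p V \<beta> c
      using V ab by (intro model)
    show "ereal (C / (c * \<beta>) * \<bar>ln e\<bar>) \<le> liminf_volume
        (\<lambda>\<Lambda>. \<integral>\<phi>. (\<phi> (0, 0))\<^sup>2 \<partial>(square_well_measure p V \<beta> a b \<Lambda>))"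
      unfolding C_def
    proof (rule liminf_volume_ge[OF finite_site_box])
      have "e = 2 * a * (exp b - 1) * sqrt (\<beta> * c)" "0 < e"
        unfolding e(1) using V(1) ab by simp_all
      then show "2 / ((18 * S + 1) * (exp 9 * (1 + exp 1))) / (c * \<beta>) * \<bar>ln e\<bar>
          \<le> (\<integral>\<phi>. (\<phi> (0, 0))\<^sup>2 \<partial>(square_well_measure p V \<beta> a b \<Lambda>))"
        if "finite \<Lambda>" "site_box (nat \<lfloor>1 / sqrt e\<rfloor>) \<subseteq> \<Lambda>" for \<Lambda>
        using that ab e(2) by (intro square_well_moment[OF S]) auto
    qed
  next
    fix V :: "real \<Rightarrow> real" and c \<epsilon> \<beta> e :: real
    assume V: "c > 0" "\<forall>x. V (- x) = V x" "convex_on UNIV V" "\<not> (\<exists>k. \<forall>x. V x = k)" "C2_function V"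
      "\<forall>x. 0 \<le> deriv (deriv V) x \<and> deriv (deriv V) x \<le> c"
      and \<epsilon>: "\<epsilon> > 0" "\<beta> > 0"
      and e: "e = \<epsilon> * sqrt (\<beta> * c)" "e \<le> 1 / 2"
    interpret gradient_model p V \<beta> c
      using V \<epsilon> by (intro model)
    show "ereal (C / (c * \<beta>) * \<bar>ln e\<bar>) \<le> liminf_volume
        (\<lambda>\<Lambda>. \<integral>\<phi>. (\<phi> (0, 0))\<^sup>2 \<partial>(delta_pinned_measure p V \<beta> \<epsilon> \<Lambda>))"
      unfolding C_def
    proof (rule liminf_volume_ge[OF finite_site_box])
      have "0 < e"
        unfolding e(1) using V(1) \<epsilon> by simp
      then show "2 / ((18 * S + 1) * (exp 9 * (1 + exp 1))) / (c * \<beta>) * \<bar>ln e\<bar>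
          \<le> (\<integral>\<phi>. (\<phi> (0, 0))\<^sup>2 \<partial>(delta_pinned_measure p V \<beta> \<epsilon> \<Lambda>))"
        if "finite \<Lambda>" "site_box (nat \<lfloor>1 / sqrt e\<rfloor>) \<subseteq> \<Lambda>" for \<Lambda>
        using that \<epsilon> e by (intro delta_pinned_moment[OF S]) auto
    qed
  qed auto
qed

end
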